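(* $\mathsf{Z}_2$ (second order arithmetic) is solid.
   Context: Models of $\mathsf{Z}_2$ are two-sorted structures $(\mathcal{M},\mathcal{A})$ where $\mathcal{M}\models\mathsf{PA}$, $\mathcal{A}$ is a collection of subsets of $M$, and $(\mathcal{M},\mathcal{A})$ satisfies the full second order comprehension scheme (and induction). A set is $\mathcal{M}$-definable iff it is definable in $\mathcal{M}$ by a first order formula with parameters; $\mathcal{M}\trianglerighteq_{\mathrm{par}}\mathcal{N}$ means the universe of $\mathcal{N}$ and the interpretations of all predicates of its language are $\mathcal{M}$-definable. A first order theory $T$ is solid iff for all models $\mathcal{M},\mathcal{M}^*,\mathcal{N}$ of $T$: if $\mathcal{M}\trianglerighteq_{\mathrm{par}}\mathcal{N}\trianglerighteq_{\mathrm{par}}\mathcal{M}^*$ and there is an $\mathcal{M}$-definable isomorphism $i_0:\mathcal{M}\to\mathcal{M}^*$, then there is an $\mathcal{M}$-definable isomorphism $i:\mathcal{M}\to\mathcal{N}$. *)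

theory Defs
  imports Main
begin

text \<open>
  Many-sorted first-order logic with equality over a relational signature. A signature is its
  arity function \<open>ar\<close>, which gives the list of argument sorts of each predicate symbol. A variable
  is a pair of a sort and an index, so the sorts of the variables are disjoint by construction.
\<close>

type_synonym 's var = "'s \<times> nat"

datatype ('s, 'p) fm =
    Rel 'p "'s var list"
  | Eq "'s var" "'s var"
  | Neg "('s, 'p) fm"
  | Conj "('s, 'p) fm" "('s, 'p) fm"
  | Ex "'s var" "('s, 'p) fm"

abbreviation Disj :: "('s, 'p) fm \<Rightarrow> ('s, 'p) fm \<Rightarrow> ('s, 'p) fm" where
  "Disj \<phi> \<psi> \<equiv> Neg (Conj (Neg \<phi>) (Neg \<psi>))"

abbreviation Imp :: "('s, 'p) fm \<Rightarrow> ('s, 'p) fm \<Rightarrow> ('s, 'p) fm" where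
  "Imp \<phi> \<psi> \<equiv> Neg (Conj \<phi> (Neg \<psi>))"

abbreviation Iff :: "('s, 'p) fm \<Rightarrow> ('s, 'p) fm \<Rightarrow> ('s, 'p) fm" where
  "Iff \<phi> \<psi> \<equiv> Conj (Imp \<phi> \<psi>) (Imp \<psi> \<phi>)"

abbreviation All :: "'s var \<Rightarrow> ('s, 'p) fm \<Rightarrow> ('s, 'p) fm" where
  "All x \<phi> \<equiv> Neg (Ex x (Neg \<phi>))"

fun fv :: "('s, 'p) fm \<Rightarrow> 's var set" where
  "fv (Rel P xs) = set xs"
| "fv (Eq x y) = {x, y}"
| "fv (Neg \<phi>) = fv \<phi>"
| "fv (Conj \<phi> \<psi>) = fv \<phi> \<union> fv \<psi>"
| "fv (Ex x \<phi>) = fv \<phi> - {x}"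

fun wf_fm :: "('p \<Rightarrow> 's list) \<Rightarrow> ('s, 'p) fm \<Rightarrow> bool" where
  "wf_fm ar (Rel P xs) \<longleftrightarrow> map fst xs = ar P"
| "wf_fm ar (Eq x y) \<longleftrightarrow> fst x = fst y"
| "wf_fm ar (Neg \<phi>) \<longleftrightarrow> wf_fm ar \<phi>"
| "wf_fm ar (Conj \<phi> \<psi>) \<longleftrightarrow> wf_fm ar \<phi> \<and> wf_fm ar \<psi>"
| "wf_fm ar (Ex x \<phi>) \<longleftrightarrow> wf_fm ar \<phi>"

text \<open>
  The universes of different sorts may overlap as sets; this is harmless, since every position of
  a tuple carries an explicit sort.
\<close>

record ('s, 'p, 'a) struct =
  univ :: "'s \<Rightarrow> 'a set"
  rel :: "'p \<Rightarrow> 'a list set"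

definition tuples :: "('s, 'p, 'a) struct \<Rightarrow> 's list \<Rightarrow> 'a list set" where
  "tuples M ss = listset (map (univ M) ss)"

definition is_struct :: "('p \<Rightarrow> 's list) \<Rightarrow> ('s, 'p, 'a) struct \<Rightarrow> bool" where
  "is_struct ar M \<longleftrightarrow> (\<forall>s. univ M s \<noteq> {}) \<and> (\<forall>P. rel M P \<subseteq> tuples M (ar P))"

definition valuations :: "('s, 'p, 'a) struct \<Rightarrow> ('s var \<Rightarrow> 'a) set" where
  "valuations M = {e. \<forall>x. e x \<in> univ M (fst x)}"

fun sat :: "('s, 'p, 'a) struct \<Rightarrow> ('s var \<Rightarrow> 'a) \<Rightarrow> ('s, 'p) fm \<Rightarrow> bool" where
  "sat M e (Rel P xs) \<longleftrightarrow> map e xs \<in> rel M P"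
| "sat M e (Eq x y) \<longleftrightarrow> e x = e y"
| "sat M e (Neg \<phi>) \<longleftrightarrow> \<not> sat M e \<phi>"
| "sat M e (Conj \<phi> \<psi>) \<longleftrightarrow> sat M e \<phi> \<and> sat M e \<psi>"
| "sat M e (Ex x \<phi>) \<longleftrightarrow> (\<exists>a \<in> univ M (fst x). sat M (e(x := a)) \<phi>)"

text \<open>Axioms may have free variables and stand for their universal closures.\<close>

definition is_model :: "('p \<Rightarrow> 's list) \<Rightarrow> ('s, 'p, 'a) struct \<Rightarrow> ('s, 'p) fm set \<Rightarrow> bool" where
  "is_model ar M T \<longleftrightarrow> is_struct ar M \<and> (\<forall>\<phi> \<in> T. \<forall>e \<in> valuations M. sat M e \<phi>)"

text \<open>
  \<open>X\<close> is a set of tuples of sorts \<open>ss\<close> that is first-order definable in \<open>M\<close> with parameters: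
  the variables \<open>xs\<close> stand for the entries of the tuple, and \<open>e\<close> gives the parameters, as the
  values of the remaining free variables of \<open>\<phi>\<close>.
\<close>

definition definable ::
  "('p \<Rightarrow> 's list) \<Rightarrow> ('s, 'p, 'a) struct \<Rightarrow> 's list \<Rightarrow> 'a list set \<Rightarrow> bool" where
  "definable ar M ss X \<longleftrightarrow>
     (\<exists>\<phi> xs e. wf_fm ar \<phi> \<and> distinct xs \<and> map fst xs = ss \<and> e \<in> valuations M \<and>
        X = {as \<in> tuples M ss.
               sat M (\<lambda>v. case map_of (zip xs as) v of Some a \<Rightarrow> a | None \<Rightarrow> e v) \<phi>})"

text \<open>
  The structure \<open>N\<close> is parametrically definable in \<open>M\<close>. Its elements of sort \<open>s\<close> are tuples
  from \<open>M\<close> of sorts \<open>d s\<close>, so that a tuple of elements of \<open>N\<close> is read, by concatenation, as a tuple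
  of elements of \<open>M\<close>. Equality of \<open>N\<close> is true equality of tuples.
\<close>

definition defines_struct ::
  "('p \<Rightarrow> 's list) \<Rightarrow> ('s \<Rightarrow> 's list) \<Rightarrow> ('s, 'p, 'a) struct \<Rightarrow> ('s, 'p, 'a list) struct \<Rightarrow> bool"
where
  "defines_struct ar d M N \<longleftrightarrow>
     (\<forall>s. definable ar M (d s) (univ N s)) \<and>
     (\<forall>P. definable ar M (concat (map d (ar P))) (concat ` rel N P))"

definition isomorphism ::
  "('p \<Rightarrow> 's list) \<Rightarrow> ('s, 'p, 'a) struct \<Rightarrow> ('s, 'p, 'b) struct \<Rightarrow> ('s \<Rightarrow> 'a \<Rightarrow> 'b) \<Rightarrow> bool" where
  "isomorphism ar M N i \<longleftrightarrow>
     (\<forall>s. bij_betw (i s) (univ M s) (univ N s)) \<and>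
     (\<forall>P. \<forall>as \<in> tuples M (ar P). as \<in> rel M P \<longleftrightarrow> map2 i (ar P) as \<in> rel N P)"

text \<open>
  Definability of a map is definability of its graph. The elements of the structure \<open>M'\<close> are
  tuples of tuples from \<open>M\<close>, and are flattened to tuples from \<open>M\<close>. The type argument
  is the type over which the universes of \<open>M\<close> range.
\<close>

definition solid :: "'a itself \<Rightarrow> ('p \<Rightarrow> 's list) \<Rightarrow> ('s, 'p) fm set \<Rightarrow> bool" where
  "solid (_ :: 'a itself) ar T \<longleftrightarrow>
     (\<forall>(M :: ('s, 'p, 'a) struct) (N :: ('s, 'p, 'a list) struct)
       (M' :: ('s, 'p, 'a list list) struct) d d'.
        is_model ar M T \<longrightarrow> is_model ar N T \<longrightarrow> is_model ar M' T \<longrightarrow>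
        defines_struct ar d M N \<longrightarrow> defines_struct ar d' N M' \<longrightarrow>
        (\<exists>i\<^sub>0. isomorphism ar M M' i\<^sub>0 \<and>
          (\<forall>s. definable ar M (s # concat (map d (d' s))) ((\<lambda>x. x # concat (i\<^sub>0 s x)) ` univ M s)))
        \<longrightarrow>
        (\<exists>i. isomorphism ar M N i \<and>
          (\<forall>s. definable ar M (s # d s) ((\<lambda>x. x # i s x) ` univ M s))))"

text \<open>
  Second-order arithmetic. The constants and operations of the usual language
  \<open>{0, 1, +, \<cdot>, <, \<in>}\<close> are represented by their graphs.
\<close>

datatype z2_sort = NumSort | SetSort

datatype z2_pred = PZero | POne | PAdd | PMul | PLess | PMem

fun z2_ar :: "z2_pred \<Rightarrow> z2_sort list" where
  "z2_ar PZero = [NumSort]"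
| "z2_ar POne = [NumSort]"
| "z2_ar PAdd = [NumSort, NumSort, NumSort]"
| "z2_ar PMul = [NumSort, NumSort, NumSort]"
| "z2_ar PLess = [NumSort, NumSort]"
| "z2_ar PMem = [NumSort, SetSort]"

type_synonym z2_fm = "(z2_sort, z2_pred) fm"
type_synonym z2_var = "z2_sort var"

abbreviation nv :: "nat \<Rightarrow> z2_var" where "nv k \<equiv> (NumSort, k)"
abbreviation sv :: "nat \<Rightarrow> z2_var" where "sv k \<equiv> (SetSort, k)"

abbreviation Zero :: "z2_var \<Rightarrow> z2_fm" where "Zero x \<equiv> Rel PZero [x]"
abbreviation One :: "z2_var \<Rightarrow> z2_fm" where "One x \<equiv> Rel POne [x]"
abbreviation Less :: "z2_var \<Rightarrow> z2_var \<Rightarrow> z2_fm" where "Less x y \<equiv> Rel PLess [x, y]"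
abbreviation Mem :: "z2_var \<Rightarrow> z2_var \<Rightarrow> z2_fm" where "Mem x X \<equiv> Rel PMem [x, X]"

text \<open>\<open>Add x y z\<close> says \<open>x + y = z\<close>, and \<open>Mul x y z\<close> says \<open>x \<cdot> y = z\<close>.\<close>

abbreviation Add :: "z2_var \<Rightarrow> z2_var \<Rightarrow> z2_var \<Rightarrow> z2_fm" where "Add x y z \<equiv> Rel PAdd [x, y, z]"
abbreviation Mul :: "z2_var \<Rightarrow> z2_var \<Rightarrow> z2_var \<Rightarrow> z2_fm" where "Mul x y z \<equiv> Rel PMul [x, y, z]"

definition z2_total_axioms :: "z2_fm set" where
  "z2_total_axioms =
     {Ex (nv 0) (All (nv 1) (Iff (Zero (nv 1)) (Eq (nv 1) (nv 0)))),
      Ex (nv 0) (All (nv 1) (Iff (One (nv 1)) (Eq (nv 1) (nv 0)))),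
      Ex (nv 0) (All (nv 1) (Iff (Add (nv 2) (nv 3) (nv 1)) (Eq (nv 1) (nv 0)))),
      Ex (nv 0) (All (nv 1) (Iff (Mul (nv 2) (nv 3) (nv 1)) (Eq (nv 1) (nv 0))))}"

text \<open>
  With \<open>m = nv 0\<close> and \<open>n = nv 1\<close>, in this order: \<open>n + 1 \<noteq> 0\<close>; \<open>m + 1 = n + 1 \<longrightarrow> m = n\<close>;
  \<open>m + 0 = m\<close>; \<open>m + (n + 1) = (m + n) + 1\<close>; \<open>m \<cdot> 0 = 0\<close>; \<open>m \<cdot> (n + 1) = m \<cdot> n + m\<close>; \<open>\<not> m < 0\<close>;
  \<open>m < n + 1 \<longleftrightarrow> m < n \<or> m = n\<close>.
\<close>

definition z2_basic_axioms :: "z2_fm set" where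
  "z2_basic_axioms =
     {Imp (Conj (One (nv 2)) (Add (nv 1) (nv 2) (nv 3)))
        (Neg (Zero (nv 3))),
      Imp (Conj (One (nv 2)) (Conj (Add (nv 0) (nv 2) (nv 3)) (Add (nv 1) (nv 2) (nv 3))))
        (Eq (nv 0) (nv 1)),
      Imp (Zero (nv 2))
        (Add (nv 0) (nv 2) (nv 0)),
      Imp (Conj (One (nv 2)) (Conj (Add (nv 1) (nv 2) (nv 3))
            (Conj (Add (nv 0) (nv 3) (nv 4)) (Add (nv 0) (nv 1) (nv 5)))))
        (Add (nv 5) (nv 2) (nv 4)),
      Imp (Zero (nv 2))
        (Mul (nv 0) (nv 2) (nv 2)),
      Imp (Conj (One (nv 2)) (Conj (Add (nv 1) (nv 2) (nv 3))
            (Conj (Mul (nv 0) (nv 3) (nv 4)) (Mul (nv 0) (nv 1) (nv 5)))))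
        (Add (nv 5) (nv 0) (nv 4)),
      Imp (Zero (nv 2))
        (Neg (Less (nv 0) (nv 2))),
      Imp (Conj (One (nv 2)) (Add (nv 1) (nv 2) (nv 3)))
        (Iff (Less (nv 0) (nv 3)) (Disj (Less (nv 0) (nv 1)) (Eq (nv 0) (nv 1))))}"

text \<open>
  \<open>\<phi>(0) \<and> (\<forall>x. \<phi>(x) \<longrightarrow> \<phi>(x + 1)) \<longrightarrow> (\<forall>x. \<phi>(x))\<close>, where \<open>\<phi>(y)\<close>, for a variable \<open>y\<close> not free
  in \<open>\<phi>\<close>, is written \<open>\<exists>x. x = y \<and> \<phi>\<close> in order to avoid substitution into \<open>\<phi>\<close>.
\<close>

definition z2_induction :: "z2_fm set" where
  "z2_induction =
     {Imp (Conj
        (All x (Imp (Zero x) \<phi>))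
        (All x (Imp \<phi> (All y (Imp (Ex u (Conj (One u) (Add x u y))) (Ex x (Conj (Eq x y) \<phi>)))))))
        (All x \<phi>) | \<phi> x y u.
      wf_fm z2_ar \<phi> \<and> fst x = NumSort \<and> fst y = NumSort \<and> fst u = NumSort \<and>
      distinct [x, y, u] \<and> y \<notin> fv \<phi>}"

definition z2_comprehension :: "z2_fm set" where
  "z2_comprehension =
     {Ex X (All x (Iff (Mem x X) \<phi>)) | \<phi> x X.
      wf_fm z2_ar \<phi> \<and> fst x = NumSort \<and> fst X = SetSort \<and> X \<notin> fv \<phi>}"

text \<open>
  Extensionality makes the set sort a collection of subsets of the number sort, up to the
  identification of \<open>X\<close> with the set of numbers related to it by \<open>PMem\<close>.
\<close>

definition z2_extensionality :: "z2_fm" where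
  "z2_extensionality =
     Imp (All (nv 0) (Iff (Mem (nv 0) (sv 0)) (Mem (nv 0) (sv 1)))) (Eq (sv 0) (sv 1))"

definition Z2 :: "z2_fm set" where
  "Z2 = z2_total_axioms \<union> z2_basic_axioms \<union> z2_induction \<union> z2_comprehension
        \<union> {z2_extensionality}"

end

theory Submission
  imports Defs
begin

text \<open>
  In a model \<open>M\<close> of \<open>Z2\<close>, finite sequences of tuples are coded by sets, so definable functions can
  be iterated definably along the numbers of \<open>M\<close>. Iterating the successor of a definable model \<open>N\<close>
  yields an embedding \<open>j\<close> of the numbers of \<open>M\<close> into those of \<open>N\<close>, and likewise \<open>j'\<close> from \<open>N\<close> to
  \<open>M'\<close>. By induction in \<open>M\<close>, \<open>j' \<circ> j\<close> agrees on numbers with the given isomorphism \<open>i0\<close>; hence it is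
  onto, and so \<open>j\<close> is onto since \<open>j'\<close> is injective. On sets, \<open>X\<close> is matched with the set of
  \<open>N\<close> that has the members \<open>j m\<close> for \<open>m \<in> X\<close>. It exists by comprehension in \<open>N\<close>, where it is
  \<open>{b. j' b \<in> i0 X}\<close>, and every set of \<open>N\<close> is reached by comprehension in \<open>M\<close>.

  Definability is handled semantically: definable sets with injective tuple codings form a category
  with definable functions, closed under products, first-order operations and interpretation.
\<close>

section \<open>Formulas and definable sets of tuples\<close>

text \<open>\<open>M\<close> may be nonstandard, so iterating the successor of \<open>N\<close> from
  outside would reach standard numbers only; the iteration must be a definition inside
  \<open>M\<close>. A number of \<open>N\<close> is a tuple over \<open>M\<close> whose entries may
  be sets, so sequences of such tuples cannot in general be coded by numbers of \<open>M\<close>,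
  and sets take over that role. The delicate point is the set sort. The image of a set X under
  \<open>j\<close> is definable in \<open>M\<close>, but comprehension in \<open>N\<close> yields
  only sets definable in \<open>N\<close>, and an interpreted model need not contain every
  \<open>M\<close>-definable set of its numbers. The detour through \<open>M'\<close> removes this
  obstacle: \<open>j'\<close> is definable in \<open>N\<close>, and although \<open>i0\<close> is
  given as definable in \<open>M\<close>, its value at X is one single set of \<open>M'\<close> and
  so can serve as a parameter in \<open>N\<close>. The converse direction is direct, because
  whatever is definable in \<open>N\<close> is definable in \<open>M\<close>. Inductions in
  \<open>M\<close> are applied to predicates that mix all three models, such as
  \<open>j' (j x) = i0 NumSort x\<close>. Closure rules for definable predicates and functions
  settle their definability without any formula being written down.\<close>

lemma finite_fv: "finite (fv \<phi>)"
  by (induction \<phi>) auto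

lemma sat_cong_fv: "(\<And>v. v \<in> fv \<phi> \<Longrightarrow> e v = e' v) \<Longrightarrow> sat M e \<phi> = sat M e' \<phi>"
proof (induction \<phi> arbitrary: e e')
  case (Rel P xs)
  then have "map e xs = map e' xs" by simp
  then show ?case by (simp only: sat.simps)
next
  case (Neg \<phi>)
  show ?case using Neg.IH[of e e'] Neg.prems by simp
next
  case (Conj \<phi> \<psi>)
  show ?case using Conj.IH(1)[of e e'] Conj.IH(2)[of e e'] Conj.prems by simp
next
  case (Ex x \<phi>)
  have "sat M (e(x := a)) \<phi> = sat M (e'(x := a)) \<phi>" for a
    using Ex.prems by (intro Ex.IH) auto
  then show ?case by simp
qed auto

lemma fresh_indices:
  assumes "finite V"
  obtains k :: nat where "\<And>n. n \<ge> k \<Longrightarrow> (s, n) \<notin> V"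
proof -
  have "finite (snd ` V)" using assms by simp
  then obtain k where k: "\<And>n. n \<in> snd ` V \<Longrightarrow> n < k"
    using finite_nat_set_iff_bounded by auto
  show thesis
    by (rule that[of k]) (use k in force)
qed

text \<open>\<open>f\<close> may identify variables; this is used below to merge all variables that
  read the same entry of a tuple. A quantifier gets a bound variable outside the image of the free
  variables, so that nothing is captured.\<close>

lemma rename_fm:
  assumes "\<And>v. fst (f v) = fst v" "wf_fm ar \<phi>"
  shows "\<exists>\<psi>. wf_fm ar \<psi> \<and> (\<forall>e. sat M e \<psi> = sat M (\<lambda>v. e (f v)) \<phi>)"
  using assms
proof (induction \<phi> arbitrary: f)
  case (Rel P xs)
  have "map fst (map f xs) = map fst xs" using Rel.prems(1) by simp
  then show ?case using Rel.prems
    by (intro exI[of _ "fm.Rel P (map f xs)"]) (auto simp: comp_def)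
next
  case (Eq x y)
  then show ?case by (intro exI[of _ "fm.Eq (f x) (f y)"]) auto
next
  case (Neg \<phi>)
  then obtain \<psi> where "wf_fm ar \<psi>" "\<forall>e. sat M e \<psi> = sat M (\<lambda>v. e (f v)) \<phi>" by fastforce
  then show ?case by (intro exI[of _ "fm.Neg \<psi>"]) auto
next
  case (Conj \<phi>1 \<phi>2)
  obtain \<psi>1 where "wf_fm ar \<psi>1" "\<forall>e. sat M e \<psi>1 = sat M (\<lambda>v. e (f v)) \<phi>1"
    using Conj.IH(1)[of f] Conj.prems by auto
  moreover obtain \<psi>2 where "wf_fm ar \<psi>2" "\<forall>e. sat M e \<psi>2 = sat M (\<lambda>v. e (f v)) \<phi>2"
    using Conj.IH(2)[of f] Conj.prems by auto
  ultimately show ?case by (intro exI[of _ "fm.Conj \<psi>1 \<psi>2"]) auto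
next
  case (Ex x \<phi>)
  have "finite (f ` fv \<phi>)" by (simp add: finite_fv)
  then obtain k where k: "\<And>n. n \<ge> k \<Longrightarrow> (fst x, n) \<notin> f ` fv \<phi>"
    using fresh_indices by metis
  define y where "y = (fst x, k)"
  have y: "y \<notin> f ` fv \<phi>" using k[of k] by (simp add: y_def)
  obtain \<psi> where \<psi>: "wf_fm ar \<psi>" "\<And>e. sat M e \<psi> = sat M (\<lambda>v. e ((f(x := y)) v)) \<phi>"
  proof -
    have "\<exists>\<psi>. wf_fm ar \<psi> \<and> (\<forall>e. sat M e \<psi> = sat M (\<lambda>v. e ((f(x := y)) v)) \<phi>)"
    proof (rule Ex.IH)
      show "fst ((f(x := y)) v) = fst v" for v using Ex.prems(1) by (simp add: y_def)
    qed (use Ex.prems(2) in simp)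
    then show ?thesis using that by blast
  qed
  have "sat M (e(y := a)) \<psi> = sat M ((\<lambda>v. e (f v))(x := a)) \<phi>" for e a
    unfolding \<psi>(2) using y by (intro sat_cong_fv) auto
  then show ?case using \<psi>(1)
    by (intro exI[of _ "fm.Ex y \<psi>"]) (auto simp: y_def)
qed

section \<open>Tuples with prescribed sorts\<close>

lemma tuples_iff: "as \<in> tuples M ss \<longleftrightarrow> list_all2 (\<lambda>s a. a \<in> univ M s) ss as"
proof (induction ss arbitrary: as)
  case (Cons s ss)
  have "tuples M (s # ss) = {a # bs | a bs. a \<in> univ M s \<and> bs \<in> tuples M ss}"
    by (auto simp: tuples_def set_Cons_def)
  then show ?case by (auto simp: list_all2_Cons1 Cons.IH)
qed (simp add: tuples_def)

lemma tuples_conv_nth: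
  "as \<in> tuples M ss \<longleftrightarrow> length as = length ss \<and> (\<forall>i<length ss. as ! i \<in> univ M (ss ! i))"
  by (auto simp: tuples_iff list_all2_conv_all_nth)

lemma tuples_Nil [simp]: "tuples M [] = {[]}"
  by (auto simp: tuples_iff)

lemma tuples_Cons_iff [simp]:
  "a # as \<in> tuples M (s # ss) \<longleftrightarrow> a \<in> univ M s \<and> as \<in> tuples M ss"
  by (auto simp: tuples_iff)

lemma tuples_lengthD: "as \<in> tuples M ss \<Longrightarrow> length as = length ss"
  by (simp add: tuples_conv_nth)

text \<open>One matching length is enough: if the other pair of lengths differs, so do the total
  lengths, and both sides fail.\<close>

lemma tuples_append_iff:
  "length as = length ss \<or> length bs = length ts \<Longrightarrow>
   as @ bs \<in> tuples M (ss @ ts) \<longleftrightarrow> as \<in> tuples M ss \<and> bs \<in> tuples M ts"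
proof (cases "length as = length ss")
  case True
  then show ?thesis by (simp add: tuples_iff list_all2_append)
next
  case False
  moreover assume "length as = length ss \<or> length bs = length ts"
  ultimately have "length (as @ bs) \<noteq> length (ss @ ts)" by simp
  then show ?thesis using False tuples_lengthD by metis
qed

text \<open>What a variable of a defining formula may stand for: \<open>Inl c\<close> is a
  parameter, \<open>Inr i\<close> refers to an entry of the tuple.\<close>

definition sel :: "'a list \<Rightarrow> 'a + nat \<Rightarrow> 'a" where
  "sel as q = (case q of Inl c \<Rightarrow> c | Inr i \<Rightarrow> as ! i)"

lemma sel_simps [simp]: "sel as (Inl c) = c" "sel as (Inr i) = as ! i"
  by (simp_all add: sel_def)

locale relstruct =
  fixes ar :: "'p \<Rightarrow> 's list" and M :: "('s, 'p, 'a) struct"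
  assumes is_struct: "is_struct ar M"
begin

lemma some_univ: "(SOME a. a \<in> univ M s) \<in> univ M s"
  using is_struct unfolding is_struct_def by (metis ex_in_conv someI_ex)

lemma rel_subset: "rel M P \<subseteq> tuples M (ar P)"
  using is_struct unfolding is_struct_def by blast

definition fits :: "'s list \<Rightarrow> 's \<Rightarrow> 'a + nat \<Rightarrow> bool" where
  "fits ss s q \<longleftrightarrow> (case q of Inl c \<Rightarrow> c \<in> univ M s | Inr i \<Rightarrow> i < length ss \<and> ss ! i = s)"

lemma fits_simps [simp]:
  "fits ss s (Inl c) \<longleftrightarrow> c \<in> univ M s" "fits ss s (Inr i) \<longleftrightarrow> i < length ss \<and> ss ! i = s"
  by (simp_all add: fits_def)

lemma sel_in_univ: "as \<in> tuples M ss \<Longrightarrow> fits ss s q \<Longrightarrow> sel as q \<in> univ M s"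
  by (cases q) (auto simp: tuples_conv_nth)

text \<open>
  Every variable of the formula may be interpreted by any entry of the tuple or by any parameter,
  so that formulas can be combined without normalising their variables.
\<close>

lemma definableI:
  assumes X: "X \<subseteq> tuples M ss" and \<phi>: "wf_fm ar \<phi>"
    and \<tau>: "\<And>v. fits ss (fst v) (\<tau> v)"
    and sat: "\<And>as. as \<in> tuples M ss \<Longrightarrow> as \<in> X \<longleftrightarrow> sat M (\<lambda>v. sel as (\<tau> v)) \<phi>"
  shows "definable ar M ss X"
proof -
  define n where "n = length ss"
  \<comment> \<open>Normal form of the variables: those that read entry \<open>i\<close> become the
    variable with index \<open>i\<close>, and those that stand for parameters move to indices from
    \<open>n\<close> on, where \<open>e\<close> looks up their values. Elsewhere \<open>e\<close>
    takes arbitrary values of the right sort, since it must be a valuation.\<close>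
  define f where "f v = (case \<tau> v of Inr i \<Rightarrow> (fst v, i) | Inl _ \<Rightarrow> (fst v, n + snd v))" for v
  define e where "e v = (if snd v < n then (SOME a. a \<in> univ M (fst v))
    else case \<tau> (fst v, snd v - n) of Inl c \<Rightarrow> c | Inr _ \<Rightarrow> SOME a. a \<in> univ M (fst v))"
    for v :: "'s var"
  define xs where "xs = map (\<lambda>i. (ss ! i, i)) [0..<n]"
  have "fst (f v) = fst v" for v by (auto simp: f_def split: sum.split)
  then obtain \<psi> where \<psi>: "wf_fm ar \<psi>" "\<And>e. sat M e \<psi> = sat M (\<lambda>v. e (f v)) \<phi>"
    using rename_fm \<phi> by metis
  have e: "e \<in> valuations M"
  proof -
    have "e v \<in> univ M (fst v)" for v
      using \<tau>[of "(fst v, snd v - n)"] some_univ by (auto simp: e_def split: sum.split)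
    then show ?thesis unfolding valuations_def by blast
  qed
  have xs: "distinct xs" "map fst xs = ss" "length xs = n"
    by (auto simp: xs_def n_def distinct_map inj_on_def intro: nth_equalityI)
  have "as \<in> X \<longleftrightarrow> sat M (\<lambda>v. case map_of (zip xs as) v of Some a \<Rightarrow> a | None \<Rightarrow> e v) \<psi>"
    if as: "as \<in> tuples M ss" for as
  proof -
    have len: "length as = n" using as by (simp add: tuples_lengthD n_def)
    have "(case map_of (zip xs as) (f v) of Some a \<Rightarrow> a | None \<Rightarrow> e (f v)) = sel as (\<tau> v)" for v
    proof (cases "\<tau> v")
      case (Inl c)
      then have "f v \<notin> set xs" by (auto simp: f_def xs_def)
      then have "map_of (zip xs as) (f v) = None"
        using len xs by (simp add: map_of_zip_is_None)
      then show ?thesis using Inl by (simp add: f_def e_def)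
    next
      case (Inr i)
      then have "i < n" "f v = xs ! i" using \<tau>[of v] by (auto simp: f_def xs_def n_def)
      then have "map_of (zip xs as) (f v) = Some (as ! i)"
        using len xs by (simp add: map_of_zip_nth)
      then show ?thesis using Inr by simp
    qed
    then show ?thesis using sat[OF as] \<psi>(2) by simp
  qed
  then have "X = {as \<in> tuples M ss.
      sat M (\<lambda>v. case map_of (zip xs as) v of Some a \<Rightarrow> a | None \<Rightarrow> e v) \<psi>}"
    using X by auto
  then show ?thesis unfolding definable_def using \<psi>(1) xs e by blast
qed

lemma definableE:
  assumes "definable ar M ss X"
  obtains \<phi> \<tau> where "wf_fm ar \<phi>" "\<And>v. fits ss (fst v) (\<tau> v)"
    "\<And>as. as \<in> tuples M ss \<Longrightarrow> as \<in> X \<longleftrightarrow> sat M (\<lambda>v. sel as (\<tau> v)) \<phi>"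
proof -
  obtain \<phi> xs e where *: "wf_fm ar \<phi>" "distinct xs" "map fst xs = ss" "e \<in> valuations M"
    "X = {as \<in> tuples M ss.
       sat M (\<lambda>v. case map_of (zip xs as) v of Some a \<Rightarrow> a | None \<Rightarrow> e v) \<phi>}"
    using assms unfolding definable_def by blast
  define \<tau> where "\<tau> v = (case map_of (zip xs [0..<length xs]) v of Some i \<Rightarrow> Inr i
    | None \<Rightarrow> Inl (e v))" for v
  have len: "length xs = length ss" using *(3) by auto
  have fits: "fits ss (fst v) (\<tau> v)" for v
  proof (cases "v \<in> set xs")
    case True
    then obtain i where "i < length xs" "v = xs ! i" by (auto simp: in_set_conv_nth)
    then show ?thesis using *(2,3) by (auto simp: \<tau>_def map_of_zip_nth)
  next
    case False
    then have none: "map_of (zip xs [0..<length xs]) v = None" by (simp add: map_of_zip_is_None)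
    have "e v \<in> univ M (fst v)" using *(4) unfolding valuations_def by blast
    then show ?thesis unfolding \<tau>_def none by simp
  qed
  have "as \<in> X \<longleftrightarrow> sat M (\<lambda>v. sel as (\<tau> v)) \<phi>" if as: "as \<in> tuples M ss" for as
  proof -
    have "(case map_of (zip xs as) v of Some a \<Rightarrow> a | None \<Rightarrow> e v) = sel as (\<tau> v)" for v
    proof (cases "v \<in> set xs")
      case True
      then obtain i where "i < length xs" "v = xs ! i" by (auto simp: in_set_conv_nth)
      then show ?thesis
        using *(2) len tuples_lengthD[OF as] by (simp add: \<tau>_def map_of_zip_nth)
    next
      case False
      then have none: "map_of (zip xs [0..<length xs]) v = None" "map_of (zip xs as) v = None"
        using len tuples_lengthD[OF as] by (simp_all add: map_of_zip_is_None)
      show ?thesis unfolding \<tau>_def none by simp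
    qed
    then show ?thesis using as by (simp add: *(5))
  qed
  then show thesis using that *(1) fits by blast
qed

section \<open>Closure of definable sets under first-order operations\<close>

lemma definable_subset: "definable ar M ss X \<Longrightarrow> X \<subseteq> tuples M ss"
  unfolding definable_def by auto

text \<open>The formula stays the same; only the interpretation of its variables changes, by
  composing \<open>\<tau>\<close> with \<open>\<sigma>\<close>.\<close>

lemma definable_reindex:
  assumes X: "definable ar M ss X" and \<sigma>: "\<And>i. i < length ss \<Longrightarrow> fits ts (ss ! i) (\<sigma> i)"
  shows "definable ar M ts {bs \<in> tuples M ts. map (\<lambda>i. sel bs (\<sigma> i)) [0..<length ss] \<in> X}"
proof -
  obtain \<phi> \<tau> where *: "wf_fm ar \<phi>" "\<And>v. fits ss (fst v) (\<tau> v)"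
    "\<And>as. as \<in> tuples M ss \<Longrightarrow> as \<in> X \<longleftrightarrow> sat M (\<lambda>v. sel as (\<tau> v)) \<phi>"
    using definableE[OF X] by blast
  define \<rho> where "\<rho> v = (case \<tau> v of Inl c \<Rightarrow> Inl c | Inr i \<Rightarrow> \<sigma> i)" for v
  show ?thesis
  proof (rule definableI[where \<phi> = \<phi> and \<tau> = \<rho>])
    show "fits ts (fst v) (\<rho> v)" for v
      using *(2)[of v] \<sigma> by (cases "\<tau> v") (simp_all add: \<rho>_def, metis)
    show "bs \<in> {bs \<in> tuples M ts. map (\<lambda>i. sel bs (\<sigma> i)) [0..<length ss] \<in> X} \<longleftrightarrow>
        sat M (\<lambda>v. sel bs (\<rho> v)) \<phi>" if bs: "bs \<in> tuples M ts" for bs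
    proof -
      let ?as = "map (\<lambda>i. sel bs (\<sigma> i)) [0..<length ss]"
      have "?as \<in> tuples M ss"
        using \<sigma> sel_in_univ[OF bs] by (simp add: tuples_conv_nth)
      moreover have "sel ?as (\<tau> v) = sel bs (\<rho> v)" for v
        using *(2)[of v] by (auto simp: \<rho>_def split: sum.split)
      ultimately show ?thesis using *(3) bs by simp
    qed
  qed (auto simp: *(1))
qed

lemma definable_Int:
  assumes X: "definable ar M ss X" and Y: "definable ar M ss Y"
  shows "definable ar M ss (X \<inter> Y)"
proof -
  obtain \<phi> \<tau> where X': "wf_fm ar \<phi>" "\<And>v. fits ss (fst v) (\<tau> v)"
    "\<And>as. as \<in> tuples M ss \<Longrightarrow> as \<in> X \<longleftrightarrow> sat M (\<lambda>v. sel as (\<tau> v)) \<phi>"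
    using definableE[OF X] by blast
  obtain \<psi> \<rho> where Y': "wf_fm ar \<psi>" "\<And>v. fits ss (fst v) (\<rho> v)"
    "\<And>as. as \<in> tuples M ss \<Longrightarrow> as \<in> Y \<longleftrightarrow> sat M (\<lambda>v. sel as (\<rho> v)) \<psi>"
    using definableE[OF Y] by blast
  \<comment> \<open>Even and odd indices keep the variables of the two formulas apart, as they are
    interpreted by different maps.\<close>
  obtain \<phi>' where \<phi>': "wf_fm ar \<phi>'" "\<And>e. sat M e \<phi>' = sat M (\<lambda>v. e (fst v, 2 * snd v)) \<phi>"
    using rename_fm[of "\<lambda>v. (fst v, 2 * snd v)"] X'(1) by fastforce
  obtain \<psi>' where \<psi>': "wf_fm ar \<psi>'" "\<And>e. sat M e \<psi>' = sat M (\<lambda>v. e (fst v, 2 * snd v + 1)) \<psi>"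
    using rename_fm[of "\<lambda>v. (fst v, 2 * snd v + 1)"] Y'(1) by fastforce
  define \<upsilon> where "\<upsilon> v = (if even (snd v) then \<tau> (fst v, snd v div 2) else \<rho> (fst v, snd v div 2))" for v
  show ?thesis
  proof (rule definableI[where \<phi> = "Conj \<phi>' \<psi>'" and \<tau> = \<upsilon>])
    show "fits ss (fst v) (\<upsilon> v)" for v
      using X'(2)[of "(fst v, snd v div 2)"] Y'(2)[of "(fst v, snd v div 2)"]
      by (simp add: \<upsilon>_def)
    show "as \<in> X \<inter> Y \<longleftrightarrow> sat M (\<lambda>v. sel as (\<upsilon> v)) (Conj \<phi>' \<psi>')" if "as \<in> tuples M ss" for as
      using X'(3)[OF that] Y'(3)[OF that] by (simp add: \<phi>'(2) \<psi>'(2) \<upsilon>_def)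
  qed (use definable_subset[OF X] \<phi>'(1) \<psi>'(1) in auto)
qed

lemma definable_Diff:
  assumes X: "definable ar M ss X"
  shows "definable ar M ss (tuples M ss - X)"
proof -
  obtain \<phi> \<tau> where *: "wf_fm ar \<phi>" "\<And>v. fits ss (fst v) (\<tau> v)"
    "\<And>as. as \<in> tuples M ss \<Longrightarrow> as \<in> X \<longleftrightarrow> sat M (\<lambda>v. sel as (\<tau> v)) \<phi>"
    using definableE[OF X] by blast
  show ?thesis by (rule definableI[where \<phi> = "Neg \<phi>" and \<tau> = \<tau>]) (use * in auto)
qed

lemma definable_Ex_last:
  assumes R: "definable ar M (ss @ [t]) R"
  shows "definable ar M ss {as \<in> tuples M ss. \<exists>b\<in>univ M t. as @ [b] \<in> R}"
proof -
  obtain \<phi> \<tau> where *: "wf_fm ar \<phi>" "\<And>v. fits (ss @ [t]) (fst v) (\<tau> v)"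
    "\<And>as. as \<in> tuples M (ss @ [t]) \<Longrightarrow> as \<in> R \<longleftrightarrow> sat M (\<lambda>v. sel as (\<tau> v)) \<phi>"
    using definableE[OF R] by blast
  \<comment> \<open>All variables that read the last entry merge into index 0, the variable to be
    quantified; the others move up by one to make room for it.\<close>
  define f where "f v = (if \<tau> v = Inr (length ss) then (fst v, 0) else (fst v, Suc (snd v)))" for v
  have "fst (f v) = fst v" for v by (simp add: f_def)
  then obtain \<psi> where \<psi>: "wf_fm ar \<psi>" "\<And>e. sat M e \<psi> = sat M (\<lambda>v. e (f v)) \<phi>"
    using rename_fm *(1) by metis
  define \<rho> where "\<rho> v = (let q = \<tau> (fst v, snd v - 1) in
    if snd v = 0 \<or> q = Inr (length ss) then Inl (SOME a. a \<in> univ M (fst v)) else q)" for v :: "'s var"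
  show ?thesis
  proof (rule definableI[where \<phi> = "Ex (t, 0) \<psi>" and \<tau> = \<rho>])
    show "fits ss (fst v) (\<rho> v)" for v
      using *(2)[of "(fst v, snd v - 1)"] some_univ
      by (cases "\<tau> (fst v, snd v - 1)") (auto simp: \<rho>_def Let_def nth_append less_Suc_eq)
    show "as \<in> {as \<in> tuples M ss. \<exists>b\<in>univ M t. as @ [b] \<in> R} \<longleftrightarrow>
        sat M (\<lambda>v. sel as (\<rho> v)) (Ex (t, 0) \<psi>)" if as: "as \<in> tuples M ss" for as
    proof -
      have "as @ [b] \<in> R \<longleftrightarrow> sat M ((\<lambda>v. sel as (\<rho> v))((t, 0) := b)) \<psi>"
        if b: "b \<in> univ M t" for b
      proof -
        have len: "length as = length ss" using as by (rule tuples_lengthD)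
        have in_t: "as @ [b] \<in> tuples M (ss @ [t])"
          using as b by (subst tuples_append_iff) (auto simp: tuples_lengthD)
        have "((\<lambda>v. sel as (\<rho> v))((t, 0) := b)) (f v) = sel (as @ [b]) (\<tau> v)" for v
        proof (cases "\<tau> v")
          case (Inl c)
          then show ?thesis by (simp add: f_def \<rho>_def)
        next
          case (Inr i)
          have "fits (ss @ [t]) (fst v) (Inr i)" using *(2)[of v] Inr by simp
          then show ?thesis using Inr len
            by (auto simp: f_def \<rho>_def nth_append less_Suc_eq split: if_splits)
        qed
        then show ?thesis using *(3)[OF in_t] \<psi>(2) by simp
      qed
      then show ?thesis using as by auto
    qed
  qed (auto simp: \<psi>(1))
qed

text \<open>The block of quantifiers is peeled off from its end, since
  \<open>definable_Ex_last\<close> removes the last entry of a tuple.\<close>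

lemma definable_Ex:
  assumes "definable ar M (ss @ ts) R"
  shows "definable ar M ss {as \<in> tuples M ss. \<exists>bs\<in>tuples M ts. as @ bs \<in> R}"
  using assms
proof (induction ts arbitrary: R rule: rev_induct)
  case Nil
  have "{as \<in> tuples M ss. as \<in> R} = R" using definable_subset[OF Nil] by auto
  then show ?case using Nil by simp
next
  case (snoc t ts)
  let ?R = "{as \<in> tuples M (ss @ ts). \<exists>b\<in>univ M t. as @ [b] \<in> R}"
  have "{as \<in> tuples M ss. \<exists>bs\<in>tuples M ts. as @ bs \<in> ?R} =
      {as \<in> tuples M ss. \<exists>bs\<in>tuples M (ts @ [t]). as @ bs \<in> R}" (is "?A = ?B")
  proof
    show "?A \<subseteq> ?B"
    proof
      fix as assume "as \<in> ?A"
      then obtain bs b where *: "as \<in> tuples M ss" "bs \<in> tuples M ts" "b \<in> univ M t"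
        "as @ bs @ [b] \<in> R" by auto
      then have "bs @ [b] \<in> tuples M (ts @ [t])"
        by (subst tuples_append_iff) (auto simp: tuples_lengthD)
      then show "as \<in> ?B" using * by blast
    qed
    show "?B \<subseteq> ?A"
    proof
      fix as assume "as \<in> ?B"
      then obtain cs where as: "as \<in> tuples M ss" and cs: "cs \<in> tuples M (ts @ [t])" "as @ cs \<in> R"
        by auto
      have "cs \<noteq> []" using tuples_lengthD[OF cs(1)] by auto
      then obtain bs b where c: "cs = bs @ [b]" by (metis rev_exhaust)
      have "length bs = length ts" using tuples_lengthD[OF cs(1)] c by simp
      then have b: "bs \<in> tuples M ts" "b \<in> univ M t"
        using cs(1) by (simp_all add: c tuples_append_iff)
      then have "as @ bs \<in> tuples M (ss @ ts)"
        using as by (simp add: tuples_append_iff tuples_lengthD)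
      then have "as @ bs \<in> ?R" using b(2) cs(2) c by auto
      then show "as \<in> ?A" using as b(1) by blast
    qed
  qed
  moreover have "definable ar M (ss @ ts) ?R"
    by (rule definable_Ex_last) (use snoc.prems in simp)
  then have "definable ar M ss {as \<in> tuples M ss. \<exists>bs\<in>tuples M ts. as @ bs \<in> ?R}"
    by (rule snoc.IH)
  ultimately show ?case by (simp only:)
qed

lemma definable_nth_eq:
  assumes "i < length ss" "j < length ss" "ss ! i = ss ! j"
  shows "definable ar M ss {as \<in> tuples M ss. as ! i = as ! j}"
proof -
  define s where "s = ss ! i"
  define \<tau> where "\<tau> v = (if v = (s, 0) then Inr i else if v = (s, 1) then Inr j
    else Inl (SOME a. a \<in> univ M (fst v)))" for v :: "'s var"
  show ?thesis
    by (rule definableI[where \<phi> = "Eq (s, 0) (s, 1)" and \<tau> = \<tau>])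
      (use assms some_univ in \<open>auto simp: \<tau>_def s_def\<close>)
qed

lemma definable_tuples: "definable ar M ss (tuples M ss)"
proof -
  have "{as \<in> tuples M ss. True} = tuples M ss" by simp
  then show ?thesis
    using definableI[where \<phi> = "Eq (s, 0) (s, 0)" and \<tau> = "\<lambda>v. Inl (SOME a. a \<in> univ M (fst v))"]
      some_univ by fastforce
qed

lemma definable_rel: "definable ar M (ar P) (rel M P)"
proof -
  define n where "n = length (ar P)"
  define xs where "xs = map (\<lambda>i. (ar P ! i, i)) [0..<n]"
  define \<tau> where "\<tau> v = (if snd v < n \<and> ar P ! snd v = fst v then Inr (snd v)
    else Inl (SOME a. a \<in> univ M (fst v)))" for v :: "'s var"
  show ?thesis
  proof (rule definableI[where \<phi> = "Rel P xs" and \<tau> = \<tau>])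
    show "wf_fm ar (Rel P xs)"
      by (auto simp: xs_def n_def intro: nth_equalityI)
    show "as \<in> rel M P \<longleftrightarrow> sat M (\<lambda>v. sel as (\<tau> v)) (Rel P xs)" if "as \<in> tuples M (ar P)" for as
    proof -
      have "map (\<lambda>v. sel as (\<tau> v)) xs = as"
        using tuples_lengthD[OF that] by (auto simp: xs_def n_def \<tau>_def intro: nth_equalityI)
      then show ?thesis by simp
    qed
  qed (use rel_subset some_univ in \<open>auto simp: \<tau>_def n_def\<close>)
qed

lemma definable_finite_Int:
  assumes "finite I" "\<And>i. i \<in> I \<Longrightarrow> definable ar M ss {as \<in> tuples M ss. P i as}"
  shows "definable ar M ss {as \<in> tuples M ss. \<forall>i\<in>I. P i as}"
  using assms
proof (induction I)
  case empty
  then show ?case by (simp add: definable_tuples)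
next
  case (insert i I)
  have "{as \<in> tuples M ss. \<forall>i\<in>insert i I. P i as} =
      {as \<in> tuples M ss. P i as} \<inter> {as \<in> tuples M ss. \<forall>i\<in>I. P i as}" by auto
  then show ?case using insert by (simp add: definable_Int)
qed

end

section \<open>The category of definable sets\<close>
text \<open>The type of the elements is free. Pairs, elements of \<open>N\<close> and elements of
  \<open>M'\<close> can therefore all form objects over \<open>M\<close>, and predicates on them are
  stated without mention of codes.\<close>

record ('y, 's, 'a) dobj =
  car :: "'y set"
  srt :: "'s list"
  cod :: "'y \<Rightarrow> 'a list"

definition prod_obj :: "('x, 's, 'a) dobj \<Rightarrow> ('y, 's, 'a) dobj \<Rightarrow> ('x \<times> 'y, 's, 'a) dobj"
    (infixr "\<otimes>" 70) where
  "K \<otimes> L = \<lparr>car = car K \<times> car L, srt = srt K @ srt L, cod = (\<lambda>w. cod K (fst w) @ cod L (snd w))\<rparr>"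

lemma prod_obj_simps [simp]:
  "car (K \<otimes> L) = car K \<times> car L" "srt (K \<otimes> L) = srt K @ srt L"
  "cod (K \<otimes> L) w = cod K (fst w) @ cod L (snd w)"
  by (simp_all add: prod_obj_def)

context relstruct
begin

definition dobj :: "('y, 's, 'a) dobj \<Rightarrow> bool" where
  "dobj L \<longleftrightarrow> inj_on (cod L) (car L) \<and> definable ar M (srt L) (cod L ` car L)"

definition dfn :: "('y, 's, 'a) dobj \<Rightarrow> ('y \<Rightarrow> bool) \<Rightarrow> bool" where
  "dfn L P \<longleftrightarrow> definable ar M (srt L) (cod L ` {y \<in> car L. P y})"

definition dfun :: "('x, 's, 'a) dobj \<Rightarrow> ('y, 's, 'a) dobj \<Rightarrow> ('x \<Rightarrow> 'y) \<Rightarrow> bool" where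
  "dfun K L f \<longleftrightarrow> (\<forall>x\<in>car K. f x \<in> car L) \<and> dfn (K \<otimes> L) (\<lambda>w. f (fst w) = snd w)"

text \<open>
  Reindexing along such a map amounts to renaming variables and inserting parameters; it is the
  only substitution carried out on formulas.
\<close>

definition coord :: "('x, 's, 'a) dobj \<Rightarrow> ('y, 's, 'a) dobj \<Rightarrow> ('x \<Rightarrow> 'y) \<Rightarrow> bool" where
  "coord K L g \<longleftrightarrow> (\<forall>x\<in>car K. g x \<in> car L) \<and>
     (\<exists>\<sigma>. \<forall>i<length (srt L). fits (srt K) (srt L ! i) (\<sigma> i) \<and>
        (\<forall>x\<in>car K. cod L (g x) ! i = sel (cod K x) (\<sigma> i)))"

lemma dobj_cod: "dobj L \<Longrightarrow> y \<in> car L \<Longrightarrow> cod L y \<in> tuples M (srt L)"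
  using definable_subset unfolding dobj_def by blast

lemma dobj_inj: "dobj L \<Longrightarrow> y \<in> car L \<Longrightarrow> z \<in> car L \<Longrightarrow> cod L y = cod L z \<longleftrightarrow> y = z"
  unfolding dobj_def inj_on_def by blast

lemma dobj_length: "dobj L \<Longrightarrow> y \<in> car L \<Longrightarrow> length (cod L y) = length (srt L)"
  using dobj_cod tuples_lengthD by metis

lemma dfn_cong: "(\<And>y. y \<in> car L \<Longrightarrow> P y = Q y) \<Longrightarrow> dfn L P = dfn L Q"
  unfolding dfn_def by (metis (mono_tags, lifting) Collect_cong)

lemma dfun_in: "dfun K L f \<Longrightarrow> x \<in> car K \<Longrightarrow> f x \<in> car L"
  unfolding dfun_def by blast

text \<open>Since \<open>cod L\<close> is injective, the reindexed code of \<open>x\<close> is the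
  code of an element satisfying \<open>P\<close> exactly when \<open>g x\<close> satisfies
  \<open>P\<close>. An intersection then cuts out the codes of \<open>K\<close>.\<close>

lemma dfn_coord:
  assumes K: "dobj K" and L: "dobj L" and g: "coord K L g" and P: "dfn L P"
  shows "dfn K (\<lambda>x. P (g x))"
proof -
  obtain \<sigma> where \<sigma>: "\<And>i. i < length (srt L) \<Longrightarrow> fits (srt K) (srt L ! i) (\<sigma> i)"
    "\<And>i x. i < length (srt L) \<Longrightarrow> x \<in> car K \<Longrightarrow> cod L (g x) ! i = sel (cod K x) (\<sigma> i)"
    and gL: "\<And>x. x \<in> car K \<Longrightarrow> g x \<in> car L"
    using g unfolding coord_def by blast
  let ?X = "{as \<in> tuples M (srt K). map (\<lambda>i. sel as (\<sigma> i)) [0..<length (srt L)] \<in> cod L ` {y \<in> car L. P y}}"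
  have eq: "map (\<lambda>i. sel (cod K x) (\<sigma> i)) [0..<length (srt L)] = cod L (g x)" if "x \<in> car K" for x
    using that \<sigma>(2) gL dobj_length[OF L] by (auto intro!: nth_equalityI)
  have "cod K ` {x \<in> car K. P (g x)} = cod K ` car K \<inter> ?X"
  proof
    show "cod K ` {x \<in> car K. P (g x)} \<subseteq> cod K ` car K \<inter> ?X"
      using eq gL dobj_cod[OF K] by auto
    show "cod K ` car K \<inter> ?X \<subseteq> cod K ` {x \<in> car K. P (g x)}"
    proof
      fix as assume "as \<in> cod K ` car K \<inter> ?X"
      then obtain x y where x: "x \<in> car K" "as = cod K x" and y: "y \<in> car L" "P y"
        "map (\<lambda>i. sel as (\<sigma> i)) [0..<length (srt L)] = cod L y" by auto
      then have "g x = y" using eq[OF x(1)] dobj_inj[OF L gL[OF x(1)] y(1)] by simp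
      then show "as \<in> cod K ` {x \<in> car K. P (g x)}" using x y by blast
    qed
  qed
  moreover have "definable ar M (srt K) ?X"
    using P \<sigma>(1) unfolding dfn_def by (rule definable_reindex)
  ultimately show ?thesis
    using K unfolding dfn_def dobj_def by (simp add: definable_Int)
qed

lemma dfun_cong: "(\<And>x. x \<in> car K \<Longrightarrow> f x = g x) \<Longrightarrow> dfun K L f = dfun K L g"
  unfolding dfun_def using dfn_cong[of "K \<otimes> L" "\<lambda>w. f (fst w) = snd w" "\<lambda>w. g (fst w) = snd w"]
  by auto

text \<open>Concatenating codes remains injective because all codes of elements of \<open>K\<close>
  have the same length.\<close>

lemma dobj_prod [simp]:
  assumes K: "dobj K" and L: "dobj L"
  shows "dobj (K \<otimes> L)"
proof -
  let ?m = "length (srt K)" and ?n = "length (srt L)"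
  have inj: "inj_on (cod (K \<otimes> L)) (car (K \<otimes> L))"
  proof (rule inj_onI)
    fix x y assume *: "x \<in> car (K \<otimes> L)" "y \<in> car (K \<otimes> L)" "cod (K \<otimes> L) x = cod (K \<otimes> L) y"
    then have "length (cod K (fst x)) = length (cod K (fst y))"
      using dobj_length[OF K] by auto
    then have "cod K (fst x) = cod K (fst y)" "cod L (snd x) = cod L (snd y)" using *(3) by auto
    then show "x = y" using * dobj_inj[OF K] dobj_inj[OF L] by (auto simp: prod_eq_iff)
  qed
  let ?A = "{as \<in> tuples M (srt K @ srt L). map (\<lambda>i. sel as (Inr i)) [0..<?m] \<in> cod K ` car K}"
  let ?B = "{as \<in> tuples M (srt K @ srt L). map (\<lambda>i. sel as (Inr (?m + i))) [0..<?n] \<in> cod L ` car L}"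
  have "definable ar M (srt K @ srt L) ?A" "definable ar M (srt K @ srt L) ?B"
    using K L unfolding dobj_def by (intro definable_reindex; simp add: nth_append)+
  then have def: "definable ar M (srt K @ srt L) (?A \<inter> ?B)" by (rule definable_Int)
  have "?A \<inter> ?B = cod (K \<otimes> L) ` car (K \<otimes> L)"
  proof
    show "?A \<inter> ?B \<subseteq> cod (K \<otimes> L) ` car (K \<otimes> L)"
    proof
      fix as assume as: "as \<in> ?A \<inter> ?B"
      then obtain x y where xy: "x \<in> car K" "y \<in> car L" "map ((!) as) [0..<?m] = cod K x"
        "map (\<lambda>i. as ! (?m + i)) [0..<?n] = cod L y" by auto
      have "length as = ?m + ?n" using as tuples_lengthD by fastforce
      then have "as = map ((!) as) [0..<?m] @ map (\<lambda>i. as ! (?m + i)) [0..<?n]"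
        by (intro nth_equalityI) (auto simp: nth_append)
      then have "as = cod (K \<otimes> L) (x, y)" using xy by simp
      then show "as \<in> cod (K \<otimes> L) ` car (K \<otimes> L)" by (rule image_eqI) (use xy(1,2) in simp)
    qed
    show "cod (K \<otimes> L) ` car (K \<otimes> L) \<subseteq> ?A \<inter> ?B"
    proof
      fix as assume "as \<in> cod (K \<otimes> L) ` car (K \<otimes> L)"
      then obtain x y where xy: "x \<in> car K" "y \<in> car L" "as = cod K x @ cod L y" by auto
      have len: "length (cod K x) = ?m" "length (cod L y) = ?n"
        using xy K L by (simp_all add: dobj_length)
      have "map ((!) as) [0..<?m] = cod K x" "map (\<lambda>i. as ! (?m + i)) [0..<?n] = cod L y"
        using len xy by (auto intro!: nth_equalityI simp: nth_append)
      moreover have "as \<in> tuples M (srt K @ srt L)"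
        using dobj_cod[OF K xy(1)] dobj_cod[OF L xy(2)] xy(3) len by (simp add: tuples_append_iff)
      ultimately show "as \<in> ?A \<inter> ?B" using xy by simp
    qed
  qed
  then show ?thesis using inj def unfolding dobj_def by simp
qed

section \<open>First-order operations on predicates\<close>

lemma dfn_True: "dobj L \<Longrightarrow> dfn L (\<lambda>_. True)"
  unfolding dfn_def dobj_def by simp

lemma dfn_Not:
  assumes "dobj L" "dfn L P"
  shows "dfn L (\<lambda>x. \<not> P x)"
proof -
  have "cod L ` {y \<in> car L. \<not> P y} =
      cod L ` car L \<inter> (tuples M (srt L) - cod L ` {y \<in> car L. P y})"
    using dobj_cod[OF assms(1)] dobj_inj[OF assms(1)] by auto
  then show ?thesis
    using assms unfolding dfn_def dobj_def by (simp add: definable_Int definable_Diff)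
qed

lemma dfn_conj:
  assumes "dobj L" "dfn L P" "dfn L Q"
  shows "dfn L (\<lambda>x. P x \<and> Q x)"
proof -
  have "cod L ` {y \<in> car L. P y \<and> Q y} = cod L ` {y \<in> car L. P y} \<inter> cod L ` {y \<in> car L. Q y}"
    using dobj_inj[OF assms(1)] by auto
  then show ?thesis
    using assms unfolding dfn_def dobj_def by (simp add: definable_Int)
qed

text \<open>Quantifying over the elements of \<open>L\<close> amounts to quantifying over all tuples
  of the right sorts, because the relation under the quantifier contains codes only.\<close>

lemma dfn_Ex:
  assumes K: "dobj K" and L: "dobj L" and P: "dfn (K \<otimes> L) (\<lambda>w. P (fst w) (snd w))"
  shows "dfn K (\<lambda>x. \<exists>y\<in>car L. P x y)"
proof -
  let ?R = "cod (K \<otimes> L) ` {w \<in> car (K \<otimes> L). P (fst w) (snd w)}"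
  have "cod K ` {x \<in> car K. \<exists>y\<in>car L. P x y} =
      {as \<in> tuples M (srt K). \<exists>bs\<in>tuples M (srt L). as @ bs \<in> ?R}" (is "?A = ?B")
  proof
    show "?A \<subseteq> ?B"
    proof
      fix as assume "as \<in> ?A"
      then obtain x y where xy: "x \<in> car K" "as = cod K x" "y \<in> car L" "P x y" by auto
      then have "as @ cod L y \<in> ?R" by (intro image_eqI[of _ _ "(x, y)"]) auto
      then show "as \<in> ?B" using dobj_cod[OF K xy(1)] dobj_cod[OF L xy(3)] xy(2) by blast
    qed
    show "?B \<subseteq> ?A"
    proof
      fix as assume "as \<in> ?B"
      then obtain bs x y where *: "as \<in> tuples M (srt K)" "bs \<in> tuples M (srt L)" "x \<in> car K" "y \<in> car L"
        "P x y" "as @ bs = cod K x @ cod L y" by auto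
      then have "as = cod K x"
        using tuples_lengthD dobj_length[OF K *(3)] by (metis append_eq_append_conv)
      then show "as \<in> ?A" using * by blast
    qed
  qed
  moreover have "definable ar M (srt K @ srt L) ?R" using P unfolding dfn_def by simp
  ultimately show ?thesis unfolding dfn_def by (simp only: definable_Ex)
qed

lemma dfn_disj:
  assumes "dobj L" "dfn L P" "dfn L Q"
  shows "dfn L (\<lambda>x. P x \<or> Q x)"
proof -
  have "dfn L (\<lambda>x. \<not> (\<not> P x \<and> \<not> Q x))" by (intro dfn_Not dfn_conj assms)
  then show ?thesis by simp
qed

lemma dfn_imp:
  assumes "dobj L" "dfn L P" "dfn L Q"
  shows "dfn L (\<lambda>x. P x \<longrightarrow> Q x)"
  unfolding imp_conv_disj by (intro dfn_Not dfn_disj assms)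

lemma dfn_iff:
  assumes "dobj L" "dfn L P" "dfn L Q"
  shows "dfn L (\<lambda>x. P x \<longleftrightarrow> Q x)"
  unfolding iff_conv_conj_imp by (intro dfn_imp dfn_conj assms)

lemma dfn_All:
  assumes "dobj K" "dobj L" "dfn (K \<otimes> L) (\<lambda>w. P (fst w) (snd w))"
  shows "dfn K (\<lambda>x. \<forall>y\<in>car L. P x y)"
proof -
  have "dfn K (\<lambda>x. \<not> (\<exists>y\<in>car L. \<not> P x y))" by (intro dfn_Not dfn_Ex dobj_prod assms)
  then show ?thesis by simp
qed

section \<open>Coordinate maps and definable functions\<close>

lemma coord_fst: "dobj K \<Longrightarrow> coord K K' f \<Longrightarrow> dobj L \<Longrightarrow> coord (K \<otimes> L) K' (\<lambda>w. f (fst w))"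
  unfolding coord_def
proof (elim conjE exE, intro conjI exI allI impI)
  fix \<sigma> i assume *: "dobj K" "dobj L" "\<forall>i<length (srt K'). fits (srt K) (srt K' ! i) (\<sigma> i) \<and>
      (\<forall>x\<in>car K. cod K' (f x) ! i = sel (cod K x) (\<sigma> i))" "i < length (srt K')"
  then show "fits (srt (K \<otimes> L)) (srt K' ! i) (\<sigma> i)"
    by (cases "\<sigma> i") (auto simp: nth_append)
  show "\<forall>x\<in>car (K \<otimes> L). cod K' (f (fst x)) ! i = sel (cod (K \<otimes> L) x) (\<sigma> i)"
    using * by (cases "\<sigma> i") (auto simp: nth_append dobj_length)
qed auto

lemma coord_snd: "dobj L \<Longrightarrow> coord L L' f \<Longrightarrow> dobj K \<Longrightarrow> coord (K \<otimes> L) L' (\<lambda>w. f (snd w))"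
  unfolding coord_def
proof (elim conjE exE, intro conjI exI allI impI)
  fix \<sigma> i assume *: "dobj K" "dobj L" "\<forall>i<length (srt L'). fits (srt L) (srt L' ! i) (\<sigma> i) \<and>
      (\<forall>x\<in>car L. cod L' (f x) ! i = sel (cod L x) (\<sigma> i))" "i < length (srt L')"
  \<comment> \<open>References to the second factor are shifted past the code of the first.\<close>
  let ?\<tau> = "\<lambda>i. case \<sigma> i of Inl c \<Rightarrow> Inl c | Inr j \<Rightarrow> Inr (length (srt K) + j)"
  show "fits (srt (K \<otimes> L)) (srt L' ! i) (?\<tau> i)"
    using * by (cases "\<sigma> i") (auto simp: nth_append)
  show "\<forall>x\<in>car (K \<otimes> L). cod L' (f (snd x)) ! i = sel (cod (K \<otimes> L) x) (?\<tau> i)"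
    using * by (cases "\<sigma> i") (auto simp: nth_append dobj_length)
qed auto

lemma coord_same:
  assumes "srt L = srt K" "\<And>x. x \<in> car K \<Longrightarrow> g x \<in> car L" "\<And>x. x \<in> car K \<Longrightarrow> cod L (g x) = cod K x"
  shows "coord K L g"
  unfolding coord_def using assms by (auto intro!: exI[of _ Inr])

lemma coord_id: "coord K K (\<lambda>x. x)"
  by (rule coord_same) auto

lemma coord_const: "dobj L \<Longrightarrow> c \<in> car L \<Longrightarrow> coord K L (\<lambda>_. c)"
  unfolding coord_def using dobj_cod[of L c]
  by (auto intro!: exI[of _ "\<lambda>i. Inl (cod L c ! i)"] simp: tuples_conv_nth)

lemma coord_pair:
  assumes "dobj L1" "dobj L2" "coord K L1 g1" "coord K L2 g2"
  shows "coord K (L1 \<otimes> L2) (\<lambda>x. (g1 x, g2 x))"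
proof -
  let ?n = "length (srt L1)"
  obtain \<sigma>1 \<sigma>2 where *: "\<And>i. i < length (srt L1) \<Longrightarrow> fits (srt K) (srt L1 ! i) (\<sigma>1 i) \<and>
      (\<forall>x\<in>car K. cod L1 (g1 x) ! i = sel (cod K x) (\<sigma>1 i))"
    "\<And>i. i < length (srt L2) \<Longrightarrow> fits (srt K) (srt L2 ! i) (\<sigma>2 i) \<and>
      (\<forall>x\<in>car K. cod L2 (g2 x) ! i = sel (cod K x) (\<sigma>2 i))"
    and g: "\<And>x. x \<in> car K \<Longrightarrow> g1 x \<in> car L1 \<and> g2 x \<in> car L2"
    using assms(3,4) unfolding coord_def by auto
  define \<sigma> where "\<sigma> i = (if i < ?n then \<sigma>1 i else \<sigma>2 (i - ?n))" for i
  show ?thesis unfolding coord_def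
  proof (intro conjI exI[of _ \<sigma>] allI impI)
    fix i assume i: "i < length (srt (L1 \<otimes> L2))"
    show "fits (srt K) (srt (L1 \<otimes> L2) ! i) (\<sigma> i)"
      using i *(1)[of i] *(2)[of "i - ?n"] by (simp add: \<sigma>_def nth_append)
    show "\<forall>x\<in>car K. cod (L1 \<otimes> L2) (g1 x, g2 x) ! i = sel (cod K x) (\<sigma> i)"
      using i *(1)[of i] *(2)[of "i - ?n"] g dobj_length[OF assms(1)]
      by (simp add: \<sigma>_def nth_append)
  qed (use g in auto)
qed

text \<open>Codes are injective and of fixed length, so equality of elements is a finite conjunction
  of equalities between entries.\<close>

lemma dfn_diag:
  assumes L: "dobj L"
  shows "dfn (L \<otimes> L) (\<lambda>w. fst w = snd w)"
proof -
  let ?n = "length (srt L)"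
  let ?E = "{as \<in> tuples M (srt L @ srt L). \<forall>i\<in>{..<?n}. as ! i = as ! (?n + i)}"
  have E: "definable ar M (srt L @ srt L) ?E"
    by (intro definable_finite_Int definable_nth_eq) (auto simp: nth_append)
  have "cod (L \<otimes> L) ` {w \<in> car (L \<otimes> L). fst w = snd w} = cod (L \<otimes> L) ` car (L \<otimes> L) \<inter> ?E"
  proof
    show "cod (L \<otimes> L) ` {w \<in> car (L \<otimes> L). fst w = snd w} \<subseteq> cod (L \<otimes> L) ` car (L \<otimes> L) \<inter> ?E"
      using L by (intro subsetI) (auto simp: tuples_append_iff dobj_cod dobj_length nth_append image_iff)
    show "cod (L \<otimes> L) ` car (L \<otimes> L) \<inter> ?E \<subseteq> cod (L \<otimes> L) ` {w \<in> car (L \<otimes> L). fst w = snd w}"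
    proof
      fix as assume "as \<in> cod (L \<otimes> L) ` car (L \<otimes> L) \<inter> ?E"
      then obtain x y where *: "x \<in> car L" "y \<in> car L" "as = cod L x @ cod L y"
        "\<forall>i\<in>{..<?n}. as ! i = as ! (?n + i)" by auto
      have "cod L x = cod L y"
        using * dobj_length[OF L] by (auto intro!: nth_equalityI simp: nth_append)
      then have "x = y" using * dobj_inj[OF L] by simp
      then show "as \<in> cod (L \<otimes> L) ` {w \<in> car (L \<otimes> L). fst w = snd w}"
        using * by (intro image_eqI[of _ _ "(x, y)"]) auto
    qed
  qed
  moreover have "definable ar M (srt L @ srt L) (cod (L \<otimes> L) ` car (L \<otimes> L))"
    using dobj_prod[OF L L] unfolding dobj_def by simp
  ultimately show ?thesis unfolding dfn_def using E by (simp add: definable_Int)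
qed

text \<open>The graph is the preimage of the diagonal under a coordinate map.\<close>

lemma dfun_coord:
  assumes K: "dobj K" and L: "dobj L" and g: "coord K L g"
  shows "dfun K L g"
proof -
  have "coord (K \<otimes> L) (L \<otimes> L) (\<lambda>w. (g (fst w), snd w))"
    using K L g by (intro coord_pair coord_fst coord_snd coord_id)
  then have "dfn (K \<otimes> L) (\<lambda>w. fst (g (fst w), snd w) = snd (g (fst w), snd w))"
    by (rule dfn_coord[OF dobj_prod[OF K L] dobj_prod[OF L L] _ dfn_diag[OF L]])
  then show ?thesis using g unfolding dfun_def coord_def by simp
qed

text \<open>A definable function has only a graph to work with, so its value is quantified:
  \<open>P (f x)\<close> becomes \<open>\<exists>y. f x = y \<and> P y\<close>.\<close>

lemma dfn_comp:
  assumes K: "dobj K" and L: "dobj L" and f: "dfun K L f" and P: "dfn L P"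
  shows "dfn K (\<lambda>x. P (f x))"
proof -
  have "dfn (K \<otimes> L) (\<lambda>w. P (snd w))"
    by (rule dfn_coord[OF dobj_prod[OF K L] L coord_snd[OF L coord_id K] P])
  then have "dfn K (\<lambda>x. \<exists>y\<in>car L. f x = y \<and> P y)"
    using K L f unfolding dfun_def by (intro dfn_Ex dfn_conj) auto
  moreover have "dfn K (\<lambda>x. \<exists>y\<in>car L. f x = y \<and> P y) = dfn K (\<lambda>x. P (f x))"
    by (rule dfn_cong) (use dfun_in[OF f] in auto)
  ultimately show ?thesis by simp
qed

lemma dfun_pair:
  assumes "dobj K" "dobj L1" "dobj L2" "dfun K L1 f" "dfun K L2 g"
  shows "dfun K (L1 \<otimes> L2) (\<lambda>x. (f x, g x))"
proof -
  let ?W = "K \<otimes> L1 \<otimes> L2"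
  have "coord ?W (K \<otimes> L1) (\<lambda>w. (fst w, fst (snd w)))" "coord ?W (K \<otimes> L2) (\<lambda>w. (fst w, snd (snd w)))"
    using assms by (intro coord_pair coord_fst coord_snd coord_id dobj_prod; simp)+
  moreover have "dfn (K \<otimes> L1) (\<lambda>w. f (fst w) = snd w)" "dfn (K \<otimes> L2) (\<lambda>w. g (fst w) = snd w)"
    using assms unfolding dfun_def by auto
  ultimately have "dfn ?W (\<lambda>w. f (fst w) = fst (snd w))" "dfn ?W (\<lambda>w. g (fst w) = snd (snd w))"
    using dfn_coord[OF dobj_prod[OF assms(1) dobj_prod[OF assms(2,3)]] dobj_prod[OF assms(1,2)]]
      dfn_coord[OF dobj_prod[OF assms(1) dobj_prod[OF assms(2,3)]] dobj_prod[OF assms(1,3)]]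
    by fastforce+
  then have "dfn ?W (\<lambda>w. f (fst w) = fst (snd w) \<and> g (fst w) = snd (snd w))"
    using assms by (intro dfn_conj) auto
  then show ?thesis using assms unfolding dfun_def by (simp add: prod_eq_iff)
qed

lemma dfun_id [simp]: "dobj L \<Longrightarrow> dfun L L (\<lambda>x. x)"
  by (simp add: dfun_coord coord_id)

lemma dfun_const: "dobj K \<Longrightarrow> dobj L \<Longrightarrow> c \<in> car L \<Longrightarrow> dfun K L (\<lambda>_. c)"
  by (simp add: dfun_coord coord_const)

lemma dfun_comp:
  assumes "dobj K" "dobj L" "dobj L'" "dfun K L f" "dfun L L' g"
  shows "dfun K L' (\<lambda>x. g (f x))"
proof -
  let ?W = "(K \<otimes> L') \<otimes> L"
  have "coord ?W (K \<otimes> L) (\<lambda>w. (fst (fst w), snd w))" "coord ?W (L \<otimes> L') (\<lambda>w. (snd w, snd (fst w)))"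
    using assms by (intro coord_pair coord_fst coord_snd coord_id dobj_prod; simp)+
  moreover have "dfn (K \<otimes> L) (\<lambda>w. f (fst w) = snd w)" "dfn (L \<otimes> L') (\<lambda>w. g (fst w) = snd w)"
    using assms unfolding dfun_def by auto
  ultimately have 1: "dfn ?W (\<lambda>w. f (fst (fst w)) = snd w)" and 2: "dfn ?W (\<lambda>w. g (snd w) = snd (fst w))"
    using dfn_coord[OF dobj_prod[OF dobj_prod[OF assms(1,3)] assms(2)] dobj_prod[OF assms(1,2)]]
      dfn_coord[OF dobj_prod[OF dobj_prod[OF assms(1,3)] assms(2)] dobj_prod[OF assms(2,3)]]
    by fastforce+
  have "dfn (K \<otimes> L') (\<lambda>w. \<exists>y\<in>car L. f (fst w) = y \<and> g y = snd w)"
    using assms 1 2 by (intro dfn_Ex dfn_conj) auto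
  moreover have "dfn (K \<otimes> L') (\<lambda>w. \<exists>y\<in>car L. f (fst w) = y \<and> g y = snd w) =
      dfn (K \<otimes> L') (\<lambda>w. g (f (fst w)) = snd w)"
    by (rule dfn_cong) (use dfun_in[OF assms(4)] in auto)
  ultimately show ?thesis
    using assms dfun_in unfolding dfun_def by auto
qed

lemma dfun_fst: "dobj K \<Longrightarrow> dobj L \<Longrightarrow> dobj K' \<Longrightarrow> dfun K K' f \<Longrightarrow> dfun (K \<otimes> L) K' (\<lambda>w. f (fst w))"
  by (rule dfun_comp[of "K \<otimes> L" K])
    (auto intro!: dfun_coord coord_fst[where f = "\<lambda>x. x"] coord_id)

lemma dfun_snd: "dobj K \<Longrightarrow> dobj L \<Longrightarrow> dobj L' \<Longrightarrow> dfun L L' f \<Longrightarrow> dfun (K \<otimes> L) L' (\<lambda>w. f (snd w))"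
  by (rule dfun_comp[of "K \<otimes> L" L])
    (auto intro!: dfun_coord coord_snd[where f = "\<lambda>x. x"] coord_id)

lemma dfn_eq:
  assumes "dobj K" "dobj L" "dfun K L f" "dfun K L g"
  shows "dfn K (\<lambda>x. f x = g x)"
  using dfn_comp[OF assms(1) dobj_prod[OF assms(2,2)] dfun_pair[OF assms(1,2,2,3,4)] dfn_diag[OF assms(2)]]
  by simp

lemma dfun_comp2:
  assumes "dobj K" "dobj L1" "dobj L2" "dobj L" "dfun (L1 \<otimes> L2) L (\<lambda>w. h (fst w) (snd w))"
    "dfun K L1 f" "dfun K L2 g"
  shows "dfun K L (\<lambda>x. h (f x) (g x))"
  using dfun_comp[OF assms(1) dobj_prod[OF assms(2,3)] assms(4) dfun_pair[OF assms(1-3,6,7)] assms(5)]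
  by simp

lemma dfn_comp2:
  assumes "dobj K" "dobj L1" "dobj L2" "dfn (L1 \<otimes> L2) (\<lambda>w. P (fst w) (snd w))"
    "dfun K L1 f" "dfun K L2 g"
  shows "dfn K (\<lambda>x. P (f x) (g x))"
  using dfn_comp[OF assms(1) dobj_prod[OF assms(2,3)] dfun_pair[OF assms(1-3,5,6)] assms(4)]
  by simp

section \<open>Sorts and sets of tuples as objects\<close>

definition elem :: "'s \<Rightarrow> ('a, 's, 'a) dobj" where
  "elem s = \<lparr>car = univ M s, srt = [s], cod = (\<lambda>a. [a])\<rparr>"

definition tup :: "'s list \<Rightarrow> ('a list, 's, 'a) dobj" where
  "tup ss = \<lparr>car = tuples M ss, srt = ss, cod = (\<lambda>as. as)\<rparr>"

lemma elem_simps [simp]: "car (elem s) = univ M s" "srt (elem s) = [s]" "cod (elem s) a = [a]"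
  by (simp_all add: elem_def)

lemma tup_simps [simp]: "car (tup ss) = tuples M ss" "srt (tup ss) = ss" "cod (tup ss) as = as"
  by (simp_all add: tup_def)

lemma dobj_tup [simp]: "dobj (tup ss)"
  by (simp add: dobj_def definable_tuples inj_on_def)

lemma dobj_elem [simp]: "dobj (elem s)"
proof -
  have "(\<lambda>a. [a]) ` univ M s = tuples M [s]"
    by (auto simp: tuples_iff list_all2_Cons1)
  then have "cod (elem s) ` car (elem s) = tuples M [s]" by simp
  then show ?thesis by (simp add: dobj_def definable_tuples inj_on_def)
qed

lemma dfn_tup: "dfn (tup ss) P \<longleftrightarrow> definable ar M ss {as \<in> tuples M ss. P as}"
  by (simp add: dfn_def)

lemma dfn_rel: "dfn (tup (ar P)) (\<lambda>as. as \<in> rel M P)"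
proof -
  have "{as \<in> tuples M (ar P). as \<in> rel M P} = rel M P" using rel_subset by auto
  then show ?thesis by (simp add: dfn_tup definable_rel)
qed

lemma dfun_Cons:
  assumes "dobj K" "dfun K (elem s) f" "dfun K (tup ss) g"
  shows "dfun K (tup (s # ss)) (\<lambda>x. f x # g x)"
proof -
  have "coord (elem s \<otimes> tup ss) (tup (s # ss)) (\<lambda>w. fst w # snd w)"
    by (rule coord_same) auto
  then have "dfun (elem s \<otimes> tup ss) (tup (s # ss)) (\<lambda>w. fst w # snd w)"
    by (rule dfun_coord[rotated 2]) simp_all
  from dfun_comp2[OF assms(1) _ _ _ this assms(2,3)] show ?thesis by simp
qed

lemma dfun_Nil: "dobj K \<Longrightarrow> dfun K (tup []) (\<lambda>x. [])"
  by (rule dfun_const) auto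

lemma dfun_code: "dobj L \<Longrightarrow> dfun L (tup (srt L)) (cod L)"
  by (rule dfun_coord) (auto intro!: coord_same dobj_cod)

end

section \<open>Composition of interpretations\<close>
text \<open>An object over \<open>N\<close> read over \<open>M\<close>: the elements stay, and only
  their codes are flattened. Hence \<open>dfn_lift\<close> and \<open>dfun_lift\<close> carry
  definability over for one and the same predicate or function.\<close>

definition lift :: "('s \<Rightarrow> 's list) \<Rightarrow> ('y, 's, 'a list) dobj \<Rightarrow> ('y, 's, 'a) dobj" where
  "lift d L = \<lparr>car = car L, srt = concat (map d (srt L)), cod = (\<lambda>y. concat (cod L y))\<rparr>"

lemma lift_simps [simp]:
  "car (lift d L) = car L" "srt (lift d L) = concat (map d (srt L))" "cod (lift d L) y = concat (cod L y)"
  by (simp_all add: lift_def)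

lemma lift_prod: "lift d (K \<otimes> L) = lift d K \<otimes> lift d L"
  by (simp add: lift_def prod_obj_def)

locale interp =
  M: relstruct ar M + N: relstruct ar N
  for ar :: "'p \<Rightarrow> 's list" and M :: "('s, 'p, 'a) struct" and N :: "('s, 'p, 'a list) struct" +
  fixes d :: "'s \<Rightarrow> 's list"
  assumes interpreted: "defines_struct ar d M N"
begin

lemma univ_tuples: "a \<in> univ N s \<Longrightarrow> a \<in> tuples M (d s)"
  using interpreted M.definable_subset unfolding defines_struct_def by blast

text \<open>The sort of an entry determines its length, as an element of sort \<open>s\<close> is a
  tuple of sorts \<open>d s\<close>; this makes the flattened tuple uniquely readable.\<close>

lemma concat_inj:
  "as \<in> tuples N ss \<Longrightarrow> bs \<in> tuples N ss \<Longrightarrow> concat as = concat bs \<longleftrightarrow> as = bs"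
proof (induction ss arbitrary: as bs)
  case (Cons s ss)
  obtain a as' b bs' where *: "as = a # as'" "bs = b # bs'" "a \<in> univ N s" "b \<in> univ N s"
    "as' \<in> tuples N ss" "bs' \<in> tuples N ss"
    using Cons.prems by (auto simp: tuples_iff list_all2_Cons1)
  have "length a = length b" using univ_tuples *(3,4) tuples_lengthD by metis
  then show ?case using * Cons.IH by simp
qed simp

lemma dobj_lift_elem [simp]: "M.dobj (lift d (N.elem s))"
  using interpreted unfolding defines_struct_def M.dobj_def by (simp add: inj_on_def)

lemma inj_lift_tup: "inj_on (cod (lift d (N.tup ss))) (car (lift d (N.tup ss)))"
  using concat_inj by (auto simp: inj_on_def)

text \<open>By induction on the sorts: the flattened tuples are exactly the codes of the product of
  the first sort with the tuples of the remaining ones.\<close>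

lemma dobj_lift_tup [simp]: "M.dobj (lift d (N.tup ss))"
proof (induction ss)
  case Nil
  have "definable ar M [] (tuples M [])" by (rule M.definable_tuples)
  then show ?case unfolding M.dobj_def using inj_lift_tup by simp
next
  case (Cons s ss)
  let ?L = "lift d (N.elem s) \<otimes> lift d (N.tup ss)"
  have "cod ?L ` car ?L = cod (lift d (N.tup (s # ss))) ` car (lift d (N.tup (s # ss)))"
  proof
    show "cod ?L ` car ?L \<subseteq> cod (lift d (N.tup (s # ss))) ` car (lift d (N.tup (s # ss)))"
    proof
      fix x assume "x \<in> cod ?L ` car ?L"
      then obtain a as where "a \<in> univ N s" "as \<in> tuples N ss" "x = a @ concat as" by auto
      then show "x \<in> cod (lift d (N.tup (s # ss))) ` car (lift d (N.tup (s # ss)))"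
        by (intro image_eqI[of _ _ "a # as"]) auto
    qed
    show "cod (lift d (N.tup (s # ss))) ` car (lift d (N.tup (s # ss))) \<subseteq> cod ?L ` car ?L"
    proof
      fix x assume "x \<in> cod (lift d (N.tup (s # ss))) ` car (lift d (N.tup (s # ss)))"
      then obtain a as where "a \<in> univ N s" "as \<in> tuples N ss" "x = a @ concat as"
        by (auto simp: tuples_iff list_all2_Cons1)
      then show "x \<in> cod ?L ` car ?L"
        by (intro image_eqI[of _ _ "(a, as)"]) auto
    qed
  qed
  moreover have "M.dobj ?L" using Cons by simp
  ultimately show ?case using inj_lift_tup[of "s # ss"] unfolding M.dobj_def by simp
qed

lemma dfun_lift_Cons:
  assumes "M.dobj K" "M.dfun K (lift d (N.elem s)) f" "M.dfun K (lift d (N.tup ss)) g"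
  shows "M.dfun K (lift d (N.tup (s # ss))) (\<lambda>x. f x # g x)"
proof -
  have "M.coord (lift d (N.elem s) \<otimes> lift d (N.tup ss)) (lift d (N.tup (s # ss))) (\<lambda>w. fst w # snd w)"
    by (rule M.coord_same) auto
  then have "M.dfun (lift d (N.elem s) \<otimes> lift d (N.tup ss)) (lift d (N.tup (s # ss)))
      (\<lambda>w. fst w # snd w)"
    by (rule M.dfun_coord[rotated 2]) simp_all
  from M.dfun_comp2[OF assms(1) _ _ _ this assms(2,3)] show ?thesis by simp
qed

lemma dfun_lift_hd_tl:
  "M.dfun (lift d (N.tup (s # ss))) (lift d (N.elem s)) hd"
  "M.dfun (lift d (N.tup (s # ss))) (lift d (N.tup ss)) tl"
proof -
  let ?L = "lift d (N.elem s) \<otimes> lift d (N.tup ss)"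
  have "M.coord (lift d (N.tup (s # ss))) ?L (\<lambda>as. (hd as, tl as))"
    by (rule M.coord_same) (auto simp: tuples_iff list_all2_Cons1)
  then have f: "M.dfun (lift d (N.tup (s # ss))) ?L (\<lambda>as. (hd as, tl as))"
    by (rule M.dfun_coord[rotated 2]) simp_all
  have "M.dfun ?L (lift d (N.elem s)) fst" "M.dfun ?L (lift d (N.tup ss)) snd"
    by (simp_all add: M.dfun_fst[where f = "\<lambda>x. x"] M.dfun_snd[where f = "\<lambda>x. x"])
  from M.dfun_comp[OF _ _ _ f this(1)] M.dfun_comp[OF _ _ _ f this(2)]
  show "M.dfun (lift d (N.tup (s # ss))) (lift d (N.elem s)) hd"
    "M.dfun (lift d (N.tup (s # ss))) (lift d (N.tup ss)) tl" by simp_all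
qed

lemma dfn_lift_rel: "M.dfn (lift d (N.tup (ar P))) (\<lambda>as. as \<in> rel N P)"
proof -
  have "{as \<in> tuples N (ar P). as \<in> rel N P} = rel N P" using N.rel_subset by auto
  then show ?thesis
    using interpreted unfolding M.dfn_def defines_struct_def by (simp add: image_image)
qed

text \<open>If a variable occurs repeatedly in \<open>xs\<close>, its first occurrence counts; a
  quantifier can thus put its variable in front without renaming.\<close>

definition assign :: "'s var list \<Rightarrow> 'a list list \<Rightarrow> ('s var \<Rightarrow> 'a list) \<Rightarrow> 's var \<Rightarrow> 'a list" where
  "assign xs as e v = (case map_of (zip xs as) v of Some a \<Rightarrow> a | None \<Rightarrow> e v)"

lemma dfun_lift_assign:
  assumes e: "e \<in> valuations N"
  shows "M.dfun (lift d (N.tup (map fst xs))) (lift d (N.elem (fst v))) (\<lambda>as. assign xs as e v)"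
proof (induction xs)
  case Nil
  have "e v \<in> univ N (fst v)" using e unfolding valuations_def by blast
  then show ?case by (simp add: assign_def M.dfun_const)
next
  case (Cons x xs)
  let ?K = "lift d (N.tup (map fst (x # xs)))"
  have *: "assign (x # xs) as e v = (if v = x then hd as else assign xs (tl as) e v)"
    if "as \<in> car ?K" for as
    using that by (auto simp: assign_def tuples_iff list_all2_Cons1)
  have eq: "M.dfun ?K (lift d (N.elem (fst v))) (\<lambda>as. assign (x # xs) as e v) =
      M.dfun ?K (lift d (N.elem (fst v))) (\<lambda>as. if v = x then hd as else assign xs (tl as) e v)"
    using * by (rule M.dfun_cong)
  show ?case
  proof (cases "v = x")
    case True
    then show ?thesis unfolding eq by (simp add: dfun_lift_hd_tl(1))
  next
    case False
    have "M.dfun ?K (lift d (N.elem (fst v))) (\<lambda>as. assign xs (tl as) e v)"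
      using M.dfun_comp[OF _ _ _ dfun_lift_hd_tl(2) Cons.IH] by simp
    then show ?thesis unfolding eq using False by simp
  qed
qed

text \<open>The usual translation along an interpretation: atoms are definable by hypothesis,
  parameters of \<open>N\<close> become constant maps, and quantifiers over \<open>N\<close> range
  over the carriers of lifted sorts. The list \<open>xs\<close> is arbitrary in the induction
  because it grows under quantifiers.\<close>

lemma dfn_lift_sat:
  assumes e: "e \<in> valuations N"
  shows "wf_fm ar \<phi> \<Longrightarrow> M.dfn (lift d (N.tup (map fst xs))) (\<lambda>as. sat N (assign xs as e) \<phi>)"
proof (induction \<phi> arbitrary: xs)
  case (Rel P ys)
  have "M.dfun (lift d (N.tup (map fst xs))) (lift d (N.tup (map fst ys)))
      (\<lambda>as. map (assign xs as e) ys)"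
  proof (induction ys)
    case (Cons y ys)
    then show ?case using dfun_lift_Cons[OF _ dfun_lift_assign[OF e]] by simp
  qed (simp add: M.dfun_const)
  moreover have "map fst ys = ar P" using Rel by simp
  ultimately have "M.dfun (lift d (N.tup (map fst xs))) (lift d (N.tup (ar P)))
      (\<lambda>as. map (assign xs as e) ys)" by simp
  from M.dfn_comp[OF _ _ this dfn_lift_rel] show ?case by simp
next
  case (Eq x y)
  then have "M.dfun (lift d (N.tup (map fst xs))) (lift d (N.elem (fst x))) (\<lambda>as. assign xs as e y)"
    using dfun_lift_assign[OF e, of xs y] by simp
  from M.dfn_eq[OF _ _ dfun_lift_assign[OF e] this] show ?case by simp
next
  case (Neg \<phi>)
  then show ?case by (simp add: M.dfn_Not)
next
  case (Conj \<phi> \<psi>)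
  then show ?case by (simp add: M.dfn_conj)
next
  case (Ex x \<phi>)
  let ?K = "lift d (N.tup (map fst xs))" and ?E = "lift d (N.elem (fst x))"
  have upd: "(assign xs as e)(x := a) = assign (x # xs) (a # as) e" for as a
    by (auto simp: assign_def fun_eq_iff)
  have "M.dfun (?K \<otimes> ?E) (lift d (N.tup (map fst (x # xs)))) (\<lambda>w. snd w # fst w)"
    unfolding list.map
    by (intro dfun_lift_Cons M.dfun_fst[where f = "\<lambda>x. x"] M.dfun_snd[where f = "\<lambda>x. x"])
      simp_all
  from M.dfn_comp[OF _ _ this Ex.IH[of "x # xs"]]
  have "M.dfn (?K \<otimes> ?E) (\<lambda>w. sat N ((assign xs (fst w) e)(x := snd w)) \<phi>)"
    using Ex.prems by (simp add: upd)
  then have "M.dfn ?K (\<lambda>as. \<exists>a\<in>car ?E. sat N ((assign xs as e)(x := a)) \<phi>)"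
    by (intro M.dfn_Ex) simp_all
  then show ?case by simp
qed

lemma definable_lift:
  assumes "definable ar N ss X"
  shows "definable ar M (concat (map d ss)) (concat ` X)"
proof -
  obtain \<phi> xs e where "wf_fm ar \<phi>" "map fst xs = ss" "e \<in> valuations N"
    "X = {as \<in> tuples N ss. sat N (assign xs as e) \<phi>}"
    using assms unfolding definable_def assign_def by blast
  then show ?thesis
    using dfn_lift_sat[of e \<phi> xs] unfolding M.dfn_def by simp
qed

lemma dobj_lift [simp]:
  assumes "N.dobj L"
  shows "M.dobj (lift d L)"
proof -
  have "inj_on (cod (lift d L)) (car (lift d L))"
    using concat_inj[OF N.dobj_cod[OF assms] N.dobj_cod[OF assms]] N.dobj_inj[OF assms]
    by (simp add: inj_on_def)
  moreover have "definable ar M (concat (map d (srt L))) (concat ` cod L ` car L)"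
    using assms unfolding N.dobj_def by (intro definable_lift) simp
  ultimately show ?thesis unfolding M.dobj_def by (simp add: image_image)
qed

lemma dfn_lift:
  assumes "N.dfn L P"
  shows "M.dfn (lift d L) P"
proof -
  have "definable ar M (concat (map d (srt L))) (concat ` cod L ` {y \<in> car L. P y})"
    using assms unfolding N.dfn_def by (rule definable_lift)
  then show ?thesis unfolding M.dfn_def by (simp add: image_image)
qed

lemma dfun_lift: "N.dfun K L f \<Longrightarrow> M.dfun (lift d K) (lift d L) f"
  unfolding N.dfun_def M.dfun_def using dfn_lift[of "K \<otimes> L"] by (simp add: lift_prod)

end

section \<open>Models of second-order arithmetic\<close>
context relstruct
begin

lemmas dfn_Ex_univ = dfn_Ex[where L = "elem s" for s, unfolded elem_simps]
  and dfn_All_univ = dfn_All[where L = "elem s" for s, unfolded elem_simps]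

text \<open>The way back from semantic definability to a formula, needed to instantiate the schemes
  of induction and comprehension.\<close>

lemma dfn_elem_fm:
  assumes "dfn (elem s) P"
  obtains \<phi> k e where "wf_fm ar \<phi>" "e \<in> valuations M"
    "\<And>a. a \<in> univ M s \<Longrightarrow> sat M (e((s, k) := a)) \<phi> = P a"
proof -
  have "definable ar M [s] ((\<lambda>a. [a]) ` {a \<in> univ M s. P a})"
    using assms unfolding dfn_def by (simp add: elem_def)
  then obtain \<phi> xs e where *: "wf_fm ar \<phi>" "distinct xs" "map fst xs = [s]" "e \<in> valuations M"
    "(\<lambda>a. [a]) ` {a \<in> univ M s. P a} = {as \<in> tuples M [s].
       sat M (\<lambda>v. case map_of (zip xs as) v of Some a \<Rightarrow> a | None \<Rightarrow> e v) \<phi>}"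
    unfolding definable_def by (elim exE conjE) (rule that)
  obtain k where xs: "xs = [(s, k)]" using *(3) by (auto simp: map_eq_Cons_conv)
  have upd: "(\<lambda>v. case map_of (zip xs [a]) v of Some a \<Rightarrow> a | None \<Rightarrow> e v) = e((s, k) := a)" for a
    by (auto simp: xs fun_eq_iff)
  have "sat M (e((s, k) := a)) \<phi> = P a" if a: "a \<in> univ M s" for a
  proof -
    have "[a] \<in> tuples M [s]" using a by (simp add: tuples_iff)
    then have "sat M (e((s, k) := a)) \<phi> \<longleftrightarrow> [a] \<in> (\<lambda>a. [a]) ` {a \<in> univ M s. P a}"
      unfolding *(5) by (simp add: upd)
    then show ?thesis using a by auto
  qed
  then show thesis using that *(1,4) by blast
qed

end

lemma valuations_upd: "e \<in> valuations M \<Longrightarrow> a \<in> univ M (fst v) \<Longrightarrow> e(v := a) \<in> valuations M"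
  unfolding valuations_def by (auto simp del: split_paired_All)

locale z2 = relstruct z2_ar M for M :: "(z2_sort, z2_pred, 'a) struct" +
  assumes model: "is_model z2_ar M Z2"
begin

abbreviation "Num \<equiv> univ M NumSort"
abbreviation "Sets \<equiv> univ M SetSort"
abbreviation "Nm \<equiv> elem NumSort"
abbreviation "St \<equiv> elem SetSort"

text \<open>An axiom is instantiated by listing the values of its number variables in the order of
  their indices; all other variables get arbitrary values.\<close>

definition env :: "'a list \<Rightarrow> z2_var \<Rightarrow> 'a" where
  "env xs v = (if fst v = NumSort \<and> snd v < length xs then xs ! snd v
    else SOME a. a \<in> univ M (fst v))"

lemma env_valuations: "set xs \<subseteq> Num \<Longrightarrow> env xs \<in> valuations M"
  unfolding valuations_def env_def using some_univ by (auto simp: subset_iff)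

lemma axiom: "\<phi> \<in> Z2 \<Longrightarrow> e \<in> valuations M \<Longrightarrow> sat M e \<phi>"
  using model unfolding is_model_def by blast

lemma axiom_env: "\<phi> \<in> Z2 \<Longrightarrow> set xs \<subseteq> Num \<Longrightarrow> sat M (env xs) \<phi>"
  by (rule axiom[OF _ env_valuations])

section \<open>Constants, operations and relations of a model\<close>

definition "zr = (THE a. [a] \<in> rel M PZero)"
definition "on = (THE a. [a] \<in> rel M POne)"
definition "add x y = (THE z. [x, y, z] \<in> rel M PAdd)"
definition "mul x y = (THE z. [x, y, z] \<in> rel M PMul)"
definition "lt x y \<longleftrightarrow> [x, y] \<in> rel M PLess"
definition "mem x X \<longleftrightarrow> [x, X] \<in> rel M PMem"
definition "suc x = add x on"

lemma rel_univ:
  "[a] \<in> rel M PZero \<Longrightarrow> a \<in> Num" "[a] \<in> rel M POne \<Longrightarrow> a \<in> Num"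
  "[a, b, c] \<in> rel M PAdd \<Longrightarrow> c \<in> Num" "[a, b, c] \<in> rel M PMul \<Longrightarrow> c \<in> Num"
  using rel_subset[of PZero] rel_subset[of POne] rel_subset[of PAdd] rel_subset[of PMul]
  by (auto dest!: subsetD)

lemma zr_ex: "\<exists>a\<in>Num. \<forall>b\<in>Num. [b] \<in> rel M PZero \<longleftrightarrow> b = a"
proof -
  have "Ex (nv 0) (All (nv 1) (Iff (Zero (nv 1)) (Eq (nv 1) (nv 0)))) \<in> Z2"
    by (simp add: Z2_def z2_total_axioms_def)
  from axiom_env[OF this, of "[]"] show ?thesis by auto
qed

lemma on_ex: "\<exists>a\<in>Num. \<forall>b\<in>Num. [b] \<in> rel M POne \<longleftrightarrow> b = a"
proof -
  have "Ex (nv 0) (All (nv 1) (Iff (One (nv 1)) (Eq (nv 1) (nv 0)))) \<in> Z2"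
    by (simp add: Z2_def z2_total_axioms_def)
  from axiom_env[OF this, of "[]"] show ?thesis by auto
qed

lemma add_ex: "x \<in> Num \<Longrightarrow> y \<in> Num \<Longrightarrow> \<exists>a\<in>Num. \<forall>b\<in>Num. [x, y, b] \<in> rel M PAdd \<longleftrightarrow> b = a"
proof -
  assume xy: "x \<in> Num" "y \<in> Num"
  have "Ex (nv 0) (All (nv 1) (Iff (Add (nv 2) (nv 3) (nv 1)) (Eq (nv 1) (nv 0)))) \<in> Z2"
    by (simp add: Z2_def z2_total_axioms_def)
  \<comment> \<open>The free variables of the axiom are \<open>nv 2\<close> and \<open>nv 3\<close>;
    the first two entries fill the places of the bound ones.\<close>
  from axiom_env[OF this, of "[x, x, x, y]"] xy show ?thesis by (auto simp: env_def)
qed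

lemma mul_ex: "x \<in> Num \<Longrightarrow> y \<in> Num \<Longrightarrow> \<exists>a\<in>Num. \<forall>b\<in>Num. [x, y, b] \<in> rel M PMul \<longleftrightarrow> b = a"
proof -
  assume xy: "x \<in> Num" "y \<in> Num"
  have "Ex (nv 0) (All (nv 1) (Iff (Mul (nv 2) (nv 3) (nv 1)) (Eq (nv 1) (nv 0)))) \<in> Z2"
    by (simp add: Z2_def z2_total_axioms_def)
  from axiom_env[OF this, of "[x, x, x, y]"] xy show ?thesis by (auto simp: env_def)
qed

lemma zr_iff: "[a] \<in> rel M PZero \<longleftrightarrow> a = zr" and zr_Num [simp]: "zr \<in> Num"
proof -
  obtain b where b: "b \<in> Num" "\<And>a. [a] \<in> rel M PZero \<longleftrightarrow> a = b"
    using zr_ex rel_univ(1) by metis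
  have "zr = b" unfolding zr_def b(2) by simp
  then show "[a] \<in> rel M PZero \<longleftrightarrow> a = zr" "zr \<in> Num" using b by simp_all
qed

lemma on_iff: "[a] \<in> rel M POne \<longleftrightarrow> a = on" and on_Num [simp]: "on \<in> Num"
proof -
  obtain b where b: "b \<in> Num" "\<And>a. [a] \<in> rel M POne \<longleftrightarrow> a = b"
    using on_ex rel_univ(2) by metis
  have "on = b" unfolding on_def b(2) by simp
  then show "[a] \<in> rel M POne \<longleftrightarrow> a = on" "on \<in> Num" using b by simp_all
qed

lemma add_iff_Num:
  assumes "x \<in> Num" "y \<in> Num"
  shows "([x, y, z] \<in> rel M PAdd \<longleftrightarrow> z = add x y) \<and> add x y \<in> Num"
proof -
  obtain b where b: "b \<in> Num" "\<And>a. [x, y, a] \<in> rel M PAdd \<longleftrightarrow> a = b"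
    using add_ex[OF assms] rel_univ(3) by metis
  have "add x y = b" unfolding add_def b(2) by simp
  then show ?thesis using b by simp
qed

lemma mul_iff_Num:
  assumes "x \<in> Num" "y \<in> Num"
  shows "([x, y, z] \<in> rel M PMul \<longleftrightarrow> z = mul x y) \<and> mul x y \<in> Num"
proof -
  obtain b where b: "b \<in> Num" "\<And>a. [x, y, a] \<in> rel M PMul \<longleftrightarrow> a = b"
    using mul_ex[OF assms] rel_univ(4) by metis
  have "mul x y = b" unfolding mul_def b(2) by simp
  then show ?thesis using b by simp
qed

lemmas add_iff = add_iff_Num[THEN conjunct1] and add_Num [simp] = add_iff_Num[THEN conjunct2]
  and mul_iff = mul_iff_Num[THEN conjunct1] and mul_Num [simp] = mul_iff_Num[THEN conjunct2]

lemma suc_Num [simp]: "x \<in> Num \<Longrightarrow> suc x \<in> Num"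
  by (simp add: suc_def)

lemmas graph_simps = zr_iff on_iff add_iff mul_iff lt_def[symmetric] mem_def[symmetric]
  suc_def[symmetric]

lemma basic_env: "\<phi> \<in> z2_basic_axioms \<Longrightarrow> set xs \<subseteq> Num \<Longrightarrow> sat M (env xs) \<phi>"
  by (rule axiom_env) (simp add: Z2_def)

lemma suc_neq_zr [simp]: "n \<in> Num \<Longrightarrow> suc n \<noteq> zr"
  using basic_env[of "Imp (Conj (One (nv 2)) (Add (nv 1) (nv 2) (nv 3))) (Neg (Zero (nv 3)))"
    "[zr, n, on, suc n]"]
  by (simp add: z2_basic_axioms_def env_def graph_simps)

lemma suc_inj [simp]: "m \<in> Num \<Longrightarrow> n \<in> Num \<Longrightarrow> suc m = suc n \<longleftrightarrow> m = n"
  using basic_env[of "Imp (Conj (One (nv 2)) (Conj (Add (nv 0) (nv 2) (nv 3)) (Add (nv 1) (nv 2) (nv 3))))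
        (Eq (nv 0) (nv 1))" "[m, n, on, suc n]"]
  by (auto simp: z2_basic_axioms_def env_def graph_simps)

lemma add_zr [simp]: "m \<in> Num \<Longrightarrow> add m zr = m"
  using basic_env[of "Imp (Zero (nv 2)) (Add (nv 0) (nv 2) (nv 0))" "[m, m, zr]"]
  by (simp add: z2_basic_axioms_def env_def graph_simps)

lemma add_suc [simp]: "m \<in> Num \<Longrightarrow> n \<in> Num \<Longrightarrow> add m (suc n) = suc (add m n)"
  using basic_env[of "Imp (Conj (One (nv 2)) (Conj (Add (nv 1) (nv 2) (nv 3))
            (Conj (Add (nv 0) (nv 3) (nv 4)) (Add (nv 0) (nv 1) (nv 5)))))
        (Add (nv 5) (nv 2) (nv 4))" "[m, n, on, suc n, add m (suc n), add m n]"]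
  by (simp add: z2_basic_axioms_def env_def graph_simps)

lemma mul_zr [simp]: "m \<in> Num \<Longrightarrow> mul m zr = zr"
  using basic_env[of "Imp (Zero (nv 2)) (Mul (nv 0) (nv 2) (nv 2))" "[m, m, zr]"]
  by (simp add: z2_basic_axioms_def env_def graph_simps)

lemma mul_suc [simp]: "m \<in> Num \<Longrightarrow> n \<in> Num \<Longrightarrow> mul m (suc n) = add (mul m n) m"
  using basic_env[of "Imp (Conj (One (nv 2)) (Conj (Add (nv 1) (nv 2) (nv 3))
            (Conj (Mul (nv 0) (nv 3) (nv 4)) (Mul (nv 0) (nv 1) (nv 5)))))
        (Add (nv 5) (nv 0) (nv 4))" "[m, n, on, suc n, mul m (suc n), mul m n]"]
  by (simp add: z2_basic_axioms_def env_def graph_simps)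

lemma not_lt_zr [simp]: "m \<in> Num \<Longrightarrow> \<not> lt m zr"
  using basic_env[of "Imp (Zero (nv 2)) (Neg (Less (nv 0) (nv 2)))" "[m, m, zr]"]
  by (simp add: z2_basic_axioms_def env_def graph_simps)

lemma lt_suc: "m \<in> Num \<Longrightarrow> n \<in> Num \<Longrightarrow> lt m (suc n) \<longleftrightarrow> lt m n \<or> m = n"
  using basic_env[of "Imp (Conj (One (nv 2)) (Add (nv 1) (nv 2) (nv 3)))
        (Iff (Less (nv 0) (nv 3)) (Disj (Less (nv 0) (nv 1)) (Eq (nv 0) (nv 1))))"
    "[m, n, on, suc n]"]
  by (auto simp: z2_basic_axioms_def env_def graph_simps)

lemma set_ext:
  assumes "A \<in> Sets" "B \<in> Sets" "\<And>m. m \<in> Num \<Longrightarrow> mem m A \<longleftrightarrow> mem m B"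
  shows "A = B"
proof -
  have "z2_extensionality \<in> Z2" by (simp add: Z2_def)
  moreover have "(env [])(sv 0 := A, sv 1 := B) \<in> valuations M"
    using assms by (intro valuations_upd env_valuations) auto
  ultimately have "sat M ((env [])(sv 0 := A, sv 1 := B)) z2_extensionality" by (rule axiom)
  then show ?thesis using assms(3) by (simp add: z2_extensionality_def mem_def)
qed

lemma comprehension:
  assumes "dfn Nm P"
  shows "\<exists>A\<in>Sets. \<forall>m\<in>Num. mem m A \<longleftrightarrow> P m"
proof -
  obtain \<phi> k e where *: "wf_fm z2_ar \<phi>" "e \<in> valuations M"
    "\<And>a. a \<in> Num \<Longrightarrow> sat M (e(nv k := a)) \<phi> = P a"
    using dfn_elem_fm[OF assms] by metis
  obtain X where X: "fst X = SetSort" "X \<notin> fv \<phi>"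
    using fresh_indices[OF finite_fv] by (metis fst_conv order_refl)
  have "Ex X (All (nv k) (Iff (Mem (nv k) X) \<phi>)) \<in> z2_comprehension"
    unfolding z2_comprehension_def mem_Collect_eq using X *(1)
    by (intro exI[of _ \<phi>] exI[of _ "nv k"] exI[of _ X]) simp
  then have "Ex X (All (nv k) (Iff (Mem (nv k) X) \<phi>)) \<in> Z2" by (simp add: Z2_def)
  then have "sat M e (Ex X (All (nv k) (Iff (Mem (nv k) X) \<phi>)))" using *(2) by (rule axiom)
  moreover have "X \<noteq> nv k" using X(1) by auto
  ultimately obtain A where A: "A \<in> Sets"
    "\<And>a. a \<in> Num \<Longrightarrow> mem a A \<longleftrightarrow> sat M (e(X := A, nv k := a)) \<phi>"
    using X(1) by (auto simp: mem_def)
  have "sat M (e(X := A, nv k := a)) \<phi> = sat M (e(nv k := a)) \<phi>" for a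
    using X(2) by (intro sat_cong_fv) auto
  then show ?thesis using A *(3) by (intro bexI[of _ A]) simp_all
qed

lemma num_induct:
  assumes P: "dfn Nm P" and zero: "P zr" and step: "\<And>x. x \<in> Num \<Longrightarrow> P x \<Longrightarrow> P (suc x)"
    and n: "n \<in> Num"
  shows "P n"
proof -
  obtain \<phi> k e where *: "wf_fm z2_ar \<phi>" "e \<in> valuations M"
    "\<And>a. a \<in> Num \<Longrightarrow> sat M (e(nv k := a)) \<phi> = P a"
    using dfn_elem_fm[OF P] by metis
  \<comment> \<open>Two consecutive fresh indices, one for the successor \<open>y\<close> and one
    for the unit \<open>u\<close> of the scheme.\<close>
  obtain l where l: "\<And>n. n \<ge> l \<Longrightarrow> nv n \<notin> insert (nv k) (fv \<phi>)"
    using fresh_indices[of "insert (nv k) (fv \<phi>)" NumSort] by (auto simp: finite_fv)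
  define x y u where "x = nv k" and "y = nv l" and "u = nv (Suc l)"
  have xyu: "distinct [x, y, u]" "y \<notin> fv \<phi>"
    using l[of l] l[of "Suc l"] by (auto simp: x_def y_def u_def)
  let ?ax = "Imp (Conj (All x (Imp (Zero x) \<phi>))
        (All x (Imp \<phi> (All y (Imp (Ex u (Conj (One u) (Add x u y))) (Ex x (Conj (Eq x y) \<phi>)))))))
        (All x \<phi>)"
  have sorts: "fst x = NumSort" "fst y = NumSort" "fst u = NumSort"
    by (simp_all add: x_def y_def u_def)
  have "?ax \<in> z2_induction"
    unfolding z2_induction_def using *(1) xyu sorts by blast
  then have ax: "sat M e ?ax" using *(2) by (intro axiom) (simp_all add: Z2_def)
  have eq: "sat M (e(y := b, x := c)) \<phi> = sat M (e(x := c)) \<phi>" for b c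
    using xyu(2) by (intro sat_cong_fv) auto
  have sat: "sat M (e(x := a)) \<phi> = P a" if "a \<in> Num" for a
    using *(3) that by (simp add: x_def)
  have "sat M e (All x (Imp (Zero x) \<phi>))"
    using zero by (simp add: sorts zr_iff sat)
  moreover have "sat M e (All x (Imp \<phi> (All y (Imp (Ex u (Conj (One u) (Add x u y))) (Ex x (Conj (Eq x y) \<phi>))))))"
    using xyu(1) step by (auto simp: sorts graph_simps sat eq)
  ultimately have "sat M e (All x \<phi>)" using ax by (simp only: sat.simps) blast
  then show ?thesis using n by (simp add: sorts sat)
qed

section \<open>Definability of the arithmetical operations\<close>

lemma dfn_lt:
  assumes "dobj K" "dfun K Nm f" "dfun K Nm g"
  shows "dfn K (\<lambda>x. lt (f x) (g x))"
proof -
  have "dfun K (tup (z2_ar PLess)) (\<lambda>x. [f x, g x])"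
    unfolding z2_ar.simps by (intro dfun_Cons dfun_Nil assms)
  from dfn_comp[OF assms(1) _ this dfn_rel] show ?thesis by (simp add: lt_def)
qed

lemma dfn_mem:
  assumes "dobj K" "dfun K Nm f" "dfun K St g"
  shows "dfn K (\<lambda>x. mem (f x) (g x))"
proof -
  have "dfun K (tup (z2_ar PMem)) (\<lambda>x. [f x, g x])"
    unfolding z2_ar.simps by (intro dfun_Cons dfun_Nil assms)
  from dfn_comp[OF assms(1) _ this dfn_rel] show ?thesis by (simp add: mem_def)
qed

lemma dfun_add_aux: "dfun (Nm \<otimes> Nm) Nm (\<lambda>w. add (fst w) (snd w))"
  and dfun_mul_aux: "dfun (Nm \<otimes> Nm) Nm (\<lambda>w. mul (fst w) (snd w))"
proof -
  let ?W = "(Nm \<otimes> Nm) \<otimes> Nm"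
  have "dfun ?W (tup [NumSort, NumSort, NumSort]) (\<lambda>w. [fst (fst w), snd (fst w), snd w])"
    by (intro dfun_Cons dfun_Nil dfun_fst[where f = fst] dfun_fst[where f = snd]
        dfun_fst[where f = "\<lambda>x. x"] dfun_snd[where f = "\<lambda>x. x"]) simp_all
  from dfn_comp[OF _ _ this dfn_rel[of PAdd, unfolded z2_ar.simps]]
    dfn_comp[OF _ _ this dfn_rel[of PMul, unfolded z2_ar.simps]]
  have *: "dfn ?W (\<lambda>w. [fst (fst w), snd (fst w), snd w] \<in> rel M PAdd)"
    "dfn ?W (\<lambda>w. [fst (fst w), snd (fst w), snd w] \<in> rel M PMul)" by simp_all
  have "dfn ?W (\<lambda>w. add (fst (fst w)) (snd (fst w)) = snd w)"
    by (rule dfn_cong[THEN iffD1, OF _ *(1)]) (auto simp: add_iff)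
  then show "dfun (Nm \<otimes> Nm) Nm (\<lambda>w. add (fst w) (snd w))" unfolding dfun_def by auto
  have "dfn ?W (\<lambda>w. mul (fst (fst w)) (snd (fst w)) = snd w)"
    by (rule dfn_cong[THEN iffD1, OF _ *(2)]) (auto simp: mul_iff)
  then show "dfun (Nm \<otimes> Nm) Nm (\<lambda>w. mul (fst w) (snd w))" unfolding dfun_def by auto
qed

lemma dfun_add:
  assumes "dobj K" "dfun K Nm f" "dfun K Nm g"
  shows "dfun K Nm (\<lambda>x. add (f x) (g x))"
  using dfun_comp2[OF assms(1) _ _ _ dfun_add_aux assms(2,3)] by simp

lemma dfun_mul:
  assumes "dobj K" "dfun K Nm f" "dfun K Nm g"
  shows "dfun K Nm (\<lambda>x. mul (f x) (g x))"
  using dfun_comp2[OF assms(1) _ _ _ dfun_mul_aux assms(2,3)] by simp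

lemma dfun_suc:
  assumes "dobj K" "dfun K Nm f"
  shows "dfun K Nm (\<lambda>x. suc (f x))"
  unfolding suc_def using assms by (intro dfun_add dfun_const) simp_all

text \<open>Rules that follow the syntax of a predicate down to variables and constants; the
  inductions below use them to see that their predicate is definable. The object in which an
  equation holds does not occur in the conclusion of \<open>dfn_eq\<close>, so it is fixed to
  \<open>Nm\<close> here.\<close>

lemmas dfn_intros = dfn_Not dfn_conj dfn_disj dfn_imp dfn_iff dfn_Ex_univ dfn_All_univ dfn_Ex dfn_All
  dfn_lt dfn_mem dfn_eq[where L = Nm] dfun_add dfun_mul dfun_suc dfun_const dfun_id dfun_fst dfun_snd
  dobj_prod dobj_elem

section \<open>Arithmetic, coding and recursion\<close>

lemma zr_add [simp]: "x \<in> Num \<Longrightarrow> add zr x = x"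
  by (rule num_induct[where P = "\<lambda>x. add zr x = x"]) ((intro dfn_intros)?; simp)+

lemma suc_add [simp]: "x \<in> Num \<Longrightarrow> y \<in> Num \<Longrightarrow> add (suc x) y = suc (add x y)"
  by (rule num_induct[where P = "\<lambda>y. add (suc x) y = suc (add x y)"]) ((intro dfn_intros)?; simp)+

lemma suc_zr: "suc zr = on"
  by (simp add: suc_def)

lemma add_comm: "x \<in> Num \<Longrightarrow> y \<in> Num \<Longrightarrow> add x y = add y x"
  by (rule num_induct[where P = "\<lambda>y. add x y = add y x"]) ((intro dfn_intros)?; simp)+

lemma add_assoc: "x \<in> Num \<Longrightarrow> y \<in> Num \<Longrightarrow> z \<in> Num \<Longrightarrow> add (add x y) z = add x (add y z)"
  by (rule num_induct[where P = "\<lambda>z. add (add x y) z = add x (add y z)"])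
    ((intro dfn_intros)?; simp)+

lemma add_left_comm: "x \<in> Num \<Longrightarrow> y \<in> Num \<Longrightarrow> z \<in> Num \<Longrightarrow> add x (add y z) = add y (add x z)"
  by (metis add_assoc add_comm)

lemmas add_ac = add_assoc add_comm add_left_comm

lemma add_left_cancel:
  "a \<in> Num \<Longrightarrow> x \<in> Num \<Longrightarrow> y \<in> Num \<Longrightarrow> add a x = add a y \<longleftrightarrow> x = y"
  by (rule num_induct[where P = "\<lambda>a. add a x = add a y \<longleftrightarrow> x = y"]) ((intro dfn_intros)?; simp)+

lemma num_cases:
  assumes "x \<in> Num"
  obtains "x = zr" | y where "y \<in> Num" "x = suc y"
proof -
  have "x = zr \<or> (\<exists>y\<in>Num. x = suc y)"
    using assms
    by (rule num_induct[where P = "\<lambda>x. x = zr \<or> (\<exists>y\<in>Num. x = suc y)", rotated -1])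
      ((intro dfn_intros)?; simp; fail | auto)+
  then show thesis using that by blast
qed

text \<open>The axioms describe the order only by recursion on its right argument. Expressed through
  addition, it is preserved by every map that respects successor and addition, which is how
  \<open>j\<close> will be seen to be increasing.\<close>

lemma lt_iff:
  assumes "x \<in> Num" "y \<in> Num"
  shows "lt x y \<longleftrightarrow> (\<exists>z\<in>Num. y = suc (add x z))"
  using assms(2)
proof (rule num_induct[where P = "\<lambda>y. lt x y \<longleftrightarrow> (\<exists>z\<in>Num. y = suc (add x z))", rotated -1])
  show "dfn Nm (\<lambda>y. lt x y \<longleftrightarrow> (\<exists>z\<in>Num. y = suc (add x z)))"
    using assms(1) by (intro dfn_intros; simp)
  show "lt x zr \<longleftrightarrow> (\<exists>z\<in>Num. zr = suc (add x z))"
    using assms(1) suc_neq_zr by (metis add_Num not_lt_zr)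
next
  fix y assume y: "y \<in> Num" and IH: "lt x y \<longleftrightarrow> (\<exists>z\<in>Num. y = suc (add x z))"
  have "(\<exists>z\<in>Num. suc y = suc (add x z)) \<longleftrightarrow> (\<exists>z\<in>Num. y = add x z)"
    using y assms(1) by auto
  also have "\<dots> \<longleftrightarrow> (\<exists>z\<in>Num. y = suc (add x z)) \<or> x = y"
    using y assms(1) by (metis num_cases add_zr add_suc suc_Num zr_Num)
  finally show "lt x (suc y) \<longleftrightarrow> (\<exists>z\<in>Num. suc y = suc (add x z))"
    using y assms(1) IH by (simp add: lt_suc)
qed

lemma lt_suc_add [simp]: "x \<in> Num \<Longrightarrow> z \<in> Num \<Longrightarrow> lt x (suc (add x z))"
  by (auto simp: lt_iff)

lemma lt_trans:
  assumes "x \<in> Num" "y \<in> Num" "z \<in> Num" "lt x y" "lt y z"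
  shows "lt x z"
proof -
  obtain a b where "a \<in> Num" "b \<in> Num" "y = suc (add x a)" "z = suc (add y b)"
    using assms lt_iff by metis
  then have "z = suc (add x (suc (add a b)))" using assms(1) by (simp add: add_assoc)
  then show ?thesis
    using lt_suc_add[of x "suc (add a b)"] assms(1) \<open>a \<in> Num\<close> \<open>b \<in> Num\<close> by simp
qed

lemma lt_suc_self [simp]: "x \<in> Num \<Longrightarrow> lt x (suc x)"
  by (simp add: lt_suc)

lemma lt_irrefl [simp]: "x \<in> Num \<Longrightarrow> \<not> lt x x"
proof (rule num_induct[where P = "\<lambda>x. \<not> lt x x"])
  fix x assume "x \<in> Num" "\<not> lt x x"
  then show "\<not> lt (suc x) (suc x)"
    by (metis lt_suc lt_suc_self lt_trans suc_Num)
qed ((intro dfn_intros)?; simp)+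

lemma lt_trichotomy:
  assumes "x \<in> Num" "y \<in> Num"
  shows "lt x y \<or> x = y \<or> lt y x"
  using assms(1)
proof (rule num_induct[where P = "\<lambda>x. lt x y \<or> x = y \<or> lt y x", rotated -1])
  show "dfn Nm (\<lambda>x. lt x y \<or> x = y \<or> lt y x)" using assms(2) by (intro dfn_intros; simp)
  show "lt zr y \<or> zr = y \<or> lt y zr"
    using assms(2) by (cases y rule: num_cases) (auto simp: lt_iff)
next
  fix x assume x: "x \<in> Num" and "lt x y \<or> x = y \<or> lt y x"
  then consider "lt x y" | "x = y" | "lt y x" by blast
  then show "lt (suc x) y \<or> suc x = y \<or> lt y (suc x)"
  proof cases
    case 1
    then obtain z where z: "z \<in> Num" "y = suc (add x z)" using x assms(2) lt_iff by metis
    \<comment> \<open>\<open>z = zr\<close> gives \<open>suc x = y\<close>, any other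
      \<open>z\<close> gives \<open>lt (suc x) y\<close>.\<close>
    then show ?thesis using x by (cases z rule: num_cases) (auto simp: lt_iff)
  qed (use x assms(2) in \<open>simp_all add: lt_suc\<close>)
qed

section \<open>Squares and pairs of numbers\<close>

lemma suc_mul: "x \<in> Num \<Longrightarrow> y \<in> Num \<Longrightarrow> mul (suc x) y = add (mul x y) y"
  by (rule num_induct[where P = "\<lambda>y. mul (suc x) y = add (mul x y) y"])
    ((intro dfn_intros)?; simp add: add_ac)+

text \<open>The gap between squares that separates the values of \<open>pr\<close> for different
  sums. Allowing every \<open>t\<close> above \<open>s\<close> builds the monotonicity of squaring
  into the induction.\<close>

lemma lt_square:
  assumes s: "s \<in> Num" and t: "t \<in> Num"
  shows "lt s t \<longrightarrow> lt (add (mul s s) s) (mul t t)"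
  using t
proof (rule num_induct[where P = "\<lambda>t. lt s t \<longrightarrow> lt (add (mul s s) s) (mul t t)", rotated -1])
  show "dfn Nm (\<lambda>t. lt s t \<longrightarrow> lt (add (mul s s) s) (mul t t))"
    using s by (intro dfn_intros; simp)
  show "lt s zr \<longrightarrow> lt (add (mul s s) s) (mul zr zr)" using s by simp
next
  fix t assume t: "t \<in> Num" and IH: "lt s t \<longrightarrow> lt (add (mul s s) s) (mul t t)"
  have sq: "mul (suc x) (suc x) = suc (add (add (mul x x) x) x)" if "x \<in> Num" for x
  proof -
    have "mul (suc x) (suc x) = add (add (mul x x) x) (suc x)"
      using that suc_mul[of x x] mul_suc[of "suc x" x] by simp
    then show ?thesis using that by simp
  qed
  show "lt s (suc t) \<longrightarrow> lt (add (mul s s) s) (mul (suc t) (suc t))"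
  proof
    assume "lt s (suc t)"
    then consider "lt s t" | "s = t" using s t lt_suc by blast
    then show "lt (add (mul s s) s) (mul (suc t) (suc t))"
    proof cases
      case 1
      then have less: "lt (add (mul s s) s) (mul t t)" using IH by simp
      have "lt (mul t t) (mul (suc t) (suc t))"
        unfolding sq[OF t] using lt_suc_add[of "mul t t" "add t t"] t by (simp add: add_assoc)
      with less show ?thesis by (rule lt_trans[rotated 3]) (use s t in simp_all)
    next
      case 2
      then show ?thesis unfolding sq[OF t] using t by simp
    qed
  qed
qed

text \<open>Injective because \<open>s\<^sup>2 \<le> s\<^sup>2 + x \<le> s\<^sup>2 + s < (s + 1)\<^sup>2\<close> for \<open>s = x + y\<close>.\<close>

definition "pr x y = add (mul (add x y) (add x y)) x"

lemma pr_Num [simp]: "x \<in> Num \<Longrightarrow> y \<in> Num \<Longrightarrow> pr x y \<in> Num"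
  by (simp add: pr_def)

lemma dfun_pr:
  assumes "dobj K" "dfun K Nm f" "dfun K Nm g"
  shows "dfun K Nm (\<lambda>x. pr (f x) (g x))"
  unfolding pr_def by (intro dfun_add dfun_mul assms)

lemma pr_less:
  assumes "x \<in> Num" "y \<in> Num" "x' \<in> Num" "y' \<in> Num" "lt (add x y) (add x' y')"
  shows "lt (pr x y) (pr x' y')"
proof -
  let ?s = "add x y" and ?t = "add x' y'"
  have "lt (add (mul ?s ?s) ?s) (mul ?t ?t)" using assms lt_square by simp
  then obtain z where z: "z \<in> Num" "mul ?t ?t = suc (add (add (mul ?s ?s) ?s) z)"
    using assms lt_iff by (metis add_Num mul_Num)
  then have "pr x' y' = suc (add (pr x y) (add y (add z x')))"
    using assms by (simp add: pr_def add_assoc)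
  then show ?thesis using assms z(1) by simp
qed

text \<open>By trichotomy and \<open>pr_less\<close>, equal values force equal sums; then the
  squares cancel and leave \<open>x\<close>, and finally \<open>y\<close> is cancelled from the
  sum.\<close>

lemma pr_inj:
  assumes "x \<in> Num" "y \<in> Num" "x' \<in> Num" "y' \<in> Num"
  shows "pr x y = pr x' y' \<longleftrightarrow> x = x' \<and> y = y'"
proof
  assume eq: "pr x y = pr x' y'"
  have "add x y = add x' y'"
  proof (rule ccontr)
    assume "add x y \<noteq> add x' y'"
    then have "lt (add x y) (add x' y') \<or> lt (add x' y') (add x y)"
      using lt_trichotomy assms add_Num by blast
    then have "lt (pr x y) (pr x' y') \<or> lt (pr x' y') (pr x y)"
      using pr_less assms by blast
    then show False using eq assms by simp
  qed
  moreover from this have "x = x'"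
    using eq assms by (simp add: pr_def add_left_cancel)
  ultimately show "x = x' \<and> y = y'" using assms add_left_cancel by blast
qed simp

text \<open>Row \<open>n\<close> of \<open>F\<close>, read as a set of pairs: one set of the model
  stands for a sequence of sets indexed by its numbers.\<close>

definition "slice F n = (THE A. A \<in> Sets \<and> (\<forall>m\<in>Num. mem m A \<longleftrightarrow> mem (pr n m) F))"

lemma slice:
  assumes "F \<in> Sets" "n \<in> Num"
  shows "slice F n \<in> Sets \<and> (\<forall>m\<in>Num. mem m (slice F n) \<longleftrightarrow> mem (pr n m) F)"
proof -
  have "dfn Nm (\<lambda>m. mem (pr n m) F)"
    using assms by (intro dfn_intros dfun_pr; simp)
  from comprehension[OF this]
  obtain A where A: "A \<in> Sets \<and> (\<forall>m\<in>Num. mem m A \<longleftrightarrow> mem (pr n m) F)" by blast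
  have "B = A" if "B \<in> Sets \<and> (\<forall>m\<in>Num. mem m B \<longleftrightarrow> mem (pr n m) F)" for B
    using that A by (intro set_ext) auto
  with A have "\<exists>!A. A \<in> Sets \<and> (\<forall>m\<in>Num. mem m A \<longleftrightarrow> mem (pr n m) F)" by (rule ex1I)
  then show ?thesis unfolding slice_def by (rule theI')
qed

lemma slice_Sets [simp]: "F \<in> Sets \<Longrightarrow> n \<in> Num \<Longrightarrow> slice F n \<in> Sets"
  using slice by blast

lemma mem_slice [simp]:
  "F \<in> Sets \<Longrightarrow> n \<in> Num \<Longrightarrow> m \<in> Num \<Longrightarrow> mem m (slice F n) \<longleftrightarrow> mem (pr n m) F"
  using slice by blast

text \<open>By extensionality, being the slice is a statement about membership with a single
  quantifier over numbers.\<close>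

lemma dfun_slice:
  assumes "dobj K" "dfun K St f" "dfun K Nm g"
  shows "dfun K St (\<lambda>x. slice (f x) (g x))"
proof -
  have "dfn (K \<otimes> St) (\<lambda>w. \<forall>m\<in>Num. mem m (snd w) \<longleftrightarrow> mem (pr (g (fst w)) m) (f (fst w)))"
    using assms by (intro dfn_intros dfun_pr; simp)
  moreover have "(\<forall>m\<in>Num. mem m (snd w) \<longleftrightarrow> mem (pr (g (fst w)) m) (f (fst w))) \<longleftrightarrow>
      slice (f (fst w)) (g (fst w)) = snd w" if "w \<in> car (K \<otimes> St)" for w
  proof -
    have "f (fst w) \<in> Sets" "g (fst w) \<in> Num" "snd w \<in> Sets"
      using that dfun_in[OF assms(2)] dfun_in[OF assms(3)] by auto
    note * = slice[OF this(1,2)] this(3)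
    show ?thesis
    proof
      assume "\<forall>m\<in>Num. mem m (snd w) \<longleftrightarrow> mem (pr (g (fst w)) m) (f (fst w))"
      then show "slice (f (fst w)) (g (fst w)) = snd w" using * by (intro set_ext) simp_all
    next
      assume "slice (f (fst w)) (g (fst w)) = snd w"
      then show "\<forall>m\<in>Num. mem m (snd w) \<longleftrightarrow> mem (pr (g (fst w)) m) (f (fst w))"
        using *(1) by simp
    qed
  qed
  ultimately have "dfn (K \<otimes> St) (\<lambda>w. slice (f (fst w)) (g (fst w)) = snd w)"
    by (rule dfn_cong[THEN iffD1, rotated])
  then show ?thesis
    using dfun_in[OF assms(2)] dfun_in[OF assms(3)] unfolding dfun_def by simp
qed

text \<open>Serves both to begin a sequence with a given set and to give it a new entry.\<close>

lemma slice_upd: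
  assumes F: "F \<in> Sets" and n: "n \<in> Num" and A: "A \<in> Sets"
  shows "\<exists>F'\<in>Sets. slice F' n = A \<and> (\<forall>k\<in>Num. k \<noteq> n \<longrightarrow> slice F' k = slice F k)"
proof -
  let ?P = "\<lambda>z. \<exists>k\<in>Num. \<exists>m\<in>Num. z = pr k m \<and> (k = n \<and> mem m A \<or> k \<noteq> n \<and> mem z F)"
  have "dfn Nm ?P" using assms by (intro dfn_intros dfun_pr; simp)
  from comprehension[OF this]
  obtain F' where F': "F' \<in> Sets" "\<And>z. z \<in> Num \<Longrightarrow> mem z F' \<longleftrightarrow> ?P z" by blast
  have mem_F': "mem (pr k m) F' \<longleftrightarrow> k = n \<and> mem m A \<or> k \<noteq> n \<and> mem (pr k m) F"
    if "k \<in> Num" "m \<in> Num" for k m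
    using that by (auto simp: F'(2) pr_inj)
  have "slice F' n = A" using assms F'(1) mem_F' by (intro set_ext) auto
  moreover have "slice F' k = slice F k" if "k \<in> Num" "k \<noteq> n" for k
    using that assms F'(1) mem_F' by (intro set_ext) auto
  ultimately show ?thesis using F'(1) by blast
qed

text \<open>\<open>E y A\<close> means that the set \<open>A\<close> is a code of \<open>y\<close>.
  A relation admits many codes of one element, so a code of a pair can be any set with suitable
  slices at two indices, and no canonical code has to be singled out.\<close>

definition coded :: "('y, z2_sort, 'a) dobj \<Rightarrow> ('y \<Rightarrow> 'a \<Rightarrow> bool) \<Rightarrow> bool" where
  "coded L E \<longleftrightarrow> dfn (L \<otimes> St) (\<lambda>w. E (fst w) (snd w)) \<and> (\<forall>y\<in>car L. \<exists>A\<in>Sets. E y A) \<and>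
     (\<forall>y\<in>car L. \<forall>z\<in>car L. \<forall>A\<in>Sets. E y A \<longrightarrow> E z A \<longrightarrow> y = z)"

lemma coded_elem: "\<exists>E. coded (elem s) E"
proof (cases s)
  case SetSort
  have "dfn (St \<otimes> St) (\<lambda>w. fst w = snd w)" by (rule dfn_diag) simp
  then show ?thesis
    using SetSort unfolding coded_def by (intro exI[of _ "(=)"]) auto
next
  case NumSort
  let ?E = "\<lambda>n A. \<forall>m\<in>Num. mem m A \<longleftrightarrow> m = n"
  have "dfn (Nm \<otimes> St) (\<lambda>w. ?E (fst w) (snd w))" by (intro dfn_intros; simp)
  moreover have "\<exists>A\<in>Sets. ?E n A" if "n \<in> Num" for n
  proof -
    have "dfn Nm (\<lambda>m. m = n)" using that by (intro dfn_intros; simp)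
    then show ?thesis by (rule comprehension)
  qed
  moreover have "y = z" if "y \<in> Num" "z \<in> Num" "?E y A" "?E z A" for y z A
    using that by blast
  ultimately have "coded Nm ?E" unfolding coded_def elem_simps by blast
  then show ?thesis using NumSort by blast
qed

lemma coded_prod:
  assumes K: "dobj K" "coded K E" and L: "dobj L" "coded L E'"
  shows "\<exists>E''. coded (K \<otimes> L) E''"
proof -
  let ?E = "\<lambda>w A. E (fst w) (slice A zr) \<and> E' (snd w) (slice A on)"
  have "zr \<noteq> on" using suc_neq_zr[of zr] by (simp add: suc_zr)
  have "dfn (K \<otimes> St) (\<lambda>w. E (fst w) (snd w))" "dfn (L \<otimes> St) (\<lambda>w. E' (fst w) (snd w))"
    using K L unfolding coded_def by auto
  note E_intros = dfn_comp2[of _ K St E, OF _ K(1) dobj_elem this(1)]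
    dfn_comp2[of _ L St E', OF _ L(1) dobj_elem this(2)]
  have "dfn ((K \<otimes> L) \<otimes> St) (\<lambda>w. ?E (fst w) (snd w))"
    using K(1) L(1)
    by (intro E_intros dfn_intros dfun_slice dfun_fst[where f = fst] dfun_fst[where f = snd]; simp)
  moreover have "\<exists>A\<in>Sets. ?E w A" if w: "w \<in> car (K \<otimes> L)" for w
  proof -
    obtain A B where AB: "A \<in> Sets" "B \<in> Sets" "E (fst w) A" "E' (snd w) B"
    proof -
      have "fst w \<in> car K" "snd w \<in> car L" using w by auto
      then show ?thesis using K(2) L(2) that unfolding coded_def by blast
    qed
    \<comment> \<open>\<open>slice_upd\<close> asks for some set to start from; \<open>A\<close> is
      at hand.\<close>
    obtain F where F: "F \<in> Sets" "slice F zr = A"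
      using slice_upd[OF AB(1) zr_Num AB(1)] by blast
    obtain F' where F': "F' \<in> Sets" "slice F' on = B" "slice F' zr = slice F zr"
      using slice_upd[OF F(1) on_Num AB(2)] \<open>zr \<noteq> on\<close> zr_Num by blast
    show ?thesis by (rule bexI[OF _ F'(1)]) (simp add: F' F AB)
  qed
  moreover have "x = y"
    if "x \<in> car (K \<otimes> L)" "y \<in> car (K \<otimes> L)" "A \<in> Sets" "?E x A" "?E y A" for x y A
  proof (rule prod_eqI)
    have "slice A zr \<in> Sets" "slice A on \<in> Sets" using that by simp_all
    moreover have "fst x \<in> car K" "fst y \<in> car K" "snd x \<in> car L" "snd y \<in> car L"
      using that by auto
    ultimately show "fst x = fst y" "snd x = snd y"
      using that(4,5) K(2) L(2) unfolding coded_def by blast+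
  qed
  ultimately have "coded (K \<otimes> L) ?E" unfolding coded_def by blast
  then show ?thesis by blast
qed

lemma coded_inj:
  assumes "dobj K" "dobj L" "dfun K L f" "inj_on f (car K)" "coded L E"
  shows "coded K (\<lambda>x. E (f x))"
proof -
  have "dfn (L \<otimes> St) (\<lambda>w. E (fst w) (snd w))" using assms unfolding coded_def by blast
  note E_intro = dfn_comp2[of _ L St E, OF _ assms(2) dobj_elem this]
  have "dfn (K \<otimes> St) (\<lambda>w. E (f (fst w)) (snd w))"
    using assms(1-3) by (intro E_intro dfun_snd dfun_id dfun_fst dobj_prod dobj_elem; simp)
  moreover have "\<exists>A\<in>Sets. E (f x) A" if "x \<in> car K" for x
    using assms(5) dfun_in[OF assms(3) that] unfolding coded_def by blast
  moreover have "x = y" if "x \<in> car K" "y \<in> car K" "A \<in> Sets" "E (f x) A" "E (f y) A" for x y A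
  proof -
    have "f x = f y"
      using assms(5) dfun_in[OF assms(3) that(1)] dfun_in[OF assms(3) that(2)] that(3-5)
      unfolding coded_def by blast
    then show ?thesis using assms(4) that(1,2) by (simp add: inj_on_eq_iff)
  qed
  ultimately show ?thesis unfolding coded_def by blast
qed

lemma coded_tup: "\<exists>E. coded (tup ss) E"
proof (induction ss)
  case Nil
  have "coded (tup []) (\<lambda>_ _. True)"
    using some_univ[of SetSort] unfolding coded_def by (auto simp: dfn_True)
  then show ?case by blast
next
  case (Cons s ss)
  then obtain E where E: "coded (tup ss) E" by blast
  obtain E' where "coded (elem s) E'" using coded_elem by blast
  from coded_prod[OF dobj_elem this dobj_tup E]
  obtain E'' where E'': "coded (elem s \<otimes> tup ss) E''" by blast
  have f: "dfun (tup (s # ss)) (elem s \<otimes> tup ss) (\<lambda>as. (hd as, tl as))"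
    by (rule dfun_coord) (auto intro!: coord_same simp: tuples_iff list_all2_Cons1)
  have "inj_on (\<lambda>as. (hd as, tl as)) (car (tup (s # ss)))"
    by (auto simp: inj_on_def tuples_iff list_all2_Cons1)
  from coded_inj[OF dobj_tup dobj_prod[OF dobj_elem dobj_tup] f this E''] show ?case by blast
qed

text \<open>The entries of the code tuple are numbers or sets, and both can be coded by sets.
  Sequences in any definable set thereby become single sets of the model.\<close>

lemma coded_ex:
  assumes "dobj L"
  shows "\<exists>E. coded L E"
proof -
  obtain E where E: "coded (tup (srt L)) E" using coded_tup by blast
  have "inj_on (cod L) (car L)" using assms unfolding dobj_def by blast
  from coded_inj[OF assms dobj_tup dfun_code[OF assms] this E] show ?thesis by blast
qed

text \<open>As codes are not unique, two approximating sequences may differ as sets. They are never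
  compared: \<open>J_suc\<close> derives the value at \<open>suc n\<close> from a value at
  \<open>n\<close>, so uniqueness is propagated by induction.\<close>

lemma recursion:
  assumes L: "dobj L" and z: "z \<in> car L" and f: "dfun L L f"
  obtains j where "dfun Nm L j" "j zr = z" "\<And>n. n \<in> Num \<Longrightarrow> j (suc n) = f (j n)"
proof -
  obtain E where E: "dfn (L \<otimes> St) (\<lambda>w. E (fst w) (snd w))"
    "\<And>y. y \<in> car L \<Longrightarrow> \<exists>A\<in>Sets. E y A"
    "\<And>y z A. y \<in> car L \<Longrightarrow> z \<in> car L \<Longrightarrow> A \<in> Sets \<Longrightarrow> E y A \<Longrightarrow> E z A \<Longrightarrow> y = z"
    using coded_ex[OF L] unfolding coded_def by blast
  define good where "good F n \<longleftrightarrow> E z (slice F zr) \<and>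
    (\<forall>k\<in>Num. lt k n \<longrightarrow> (\<exists>y\<in>car L. E y (slice F k) \<and> E (f y) (slice F (suc k))))" for F n
  \<comment> \<open>\<open>good F n\<close>: the slices of \<open>F\<close> up to \<open>n\<close> code the iterates of \<open>f\<close> from \<open>z\<close>\<close>
  define J where "J n y \<longleftrightarrow> (\<exists>F\<in>Sets. good F n \<and> E y (slice F n))" for n y
  have fL: "f y \<in> car L" if "y \<in> car L" for y using dfun_in[OF f that] .
  have J_dfn: "dfn (Nm \<otimes> L) (\<lambda>w. J (fst w) (snd w))"
    unfolding J_def good_def using L z
    by (intro dfn_intros dfn_comp2[of _ L St E, OF _ L dobj_elem E(1)] dfun_slice
        dfun_comp[OF _ L L _ f]; simp)
  have J_zr: "J zr y \<longleftrightarrow> y = z" if y: "y \<in> car L" for y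
  proof
    assume "J zr y"
    then obtain F where "F \<in> Sets" "E z (slice F zr)" "E y (slice F zr)"
      unfolding J_def good_def by blast
    then show "y = z" using E(3) y z by (metis slice_Sets zr_Num)
  next
    assume y: "y = z"
    obtain A where A: "A \<in> Sets" "E z A" using E(2) z by blast
    obtain F where "F \<in> Sets" "slice F zr = A" using slice_upd[OF A(1) zr_Num A(1)] by blast
    then show "J zr y" unfolding J_def good_def using A y by auto
  qed
  have J_suc: "J (suc n) y \<longleftrightarrow> (\<exists>x\<in>car L. J n x \<and> y = f x)" if n: "n \<in> Num" and y: "y \<in> car L" for n y
  proof
    assume "J (suc n) y"
    then obtain F where F: "F \<in> Sets" "good F (suc n)" "E y (slice F (suc n))"
      unfolding J_def by blast
    then obtain x where x: "x \<in> car L" "E x (slice F n)" "E (f x) (slice F (suc n))"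
      using n unfolding good_def by (meson lt_suc_self)
    have "good F n" using F(2) n unfolding good_def by (simp add: lt_suc)
    then have "J n x" using F(1) x(2) unfolding J_def by blast
    \<comment> \<open>Both are coded by \<open>slice F (suc n)\<close>.\<close>
    moreover have "y = f x"
      by (rule E(3)[OF y fL[OF x(1)] _ F(3) x(3)]) (use F(1) n in simp)
    ultimately show "\<exists>x\<in>car L. J n x \<and> y = f x" using x(1) by blast
  next
    assume "\<exists>x\<in>car L. J n x \<and> y = f x"
    then obtain x F where x: "x \<in> car L" "y = f x" "E x (slice F n)" and F: "F \<in> Sets" "good F n"
      unfolding J_def by blast
    obtain A where A: "A \<in> Sets" "E y A" using E(2) y by blast
    obtain F' where F': "F' \<in> Sets" "slice F' (suc n) = A"
      "\<And>k. k \<in> Num \<Longrightarrow> k \<noteq> suc n \<Longrightarrow> slice F' k = slice F k"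
      using slice_upd[OF F(1) suc_Num[OF n] A(1)] by blast
    have neq: "n \<noteq> suc n" using n lt_irrefl lt_suc_self by metis
    have "\<exists>y\<in>car L. E y (slice F' k) \<and> E (f y) (slice F' (suc k))" if k: "k \<in> Num" "lt k (suc n)" for k
    proof (cases "k = n")
      case True
      then show ?thesis using x A F' n neq by auto
    next
      case False
      then have "lt k n" using k n lt_suc by blast
      then have "\<exists>y\<in>car L. E y (slice F k) \<and> E (f y) (slice F (suc k))"
        using F(2) k(1) unfolding good_def by blast
      \<comment> \<open>Neither \<open>k\<close> nor \<open>suc k\<close> is the rewritten index
        \<open>suc n\<close>, so both slices are those of \<open>F\<close>.\<close>
      moreover have "k \<noteq> suc n" using k n lt_irrefl by auto
      ultimately show ?thesis using F'(3) k(1) n False by simp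
    qed
    moreover have "E z (slice F' zr)" using F(2) F'(3)[of zr] n suc_neq_zr[OF n] unfolding good_def by simp
    ultimately have "good F' (suc n)" unfolding good_def by blast
    then show "J (suc n) y" unfolding J_def using F' A by auto
  qed
  have ex1: "\<exists>y\<in>car L. \<forall>x\<in>car L. J n x \<longleftrightarrow> x = y" if "n \<in> Num" for n
    using that
  proof (rule num_induct[where P = "\<lambda>n. \<exists>y\<in>car L. \<forall>x\<in>car L. J n x \<longleftrightarrow> x = y", rotated -1])
    show "dfn Nm (\<lambda>n. \<exists>y\<in>car L. \<forall>x\<in>car L. J n x \<longleftrightarrow> x = y)"
      using L by (intro dfn_Ex dfn_All dfn_iff dfn_eq[where L = L] dfn_comp2[OF _ _ _ J_dfn]
        dfun_fst dfun_snd dfun_id dobj_prod dobj_elem) simp_all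
    show "\<exists>y\<in>car L. \<forall>x\<in>car L. J zr x \<longleftrightarrow> x = y" using z J_zr by blast
  next
    fix n assume "n \<in> Num" "\<exists>y\<in>car L. \<forall>x\<in>car L. J n x \<longleftrightarrow> x = y"
    then show "\<exists>y\<in>car L. \<forall>x\<in>car L. J (suc n) x \<longleftrightarrow> x = y" using J_suc fL by metis
  qed
  define j where "j n = (THE y. y \<in> car L \<and> J n y)" for n
  have j: "j n \<in> car L" "\<And>x. x \<in> car L \<Longrightarrow> J n x \<longleftrightarrow> j n = x" if n: "n \<in> Num" for n
  proof -
    obtain y where y: "y \<in> car L" "\<And>x. x \<in> car L \<Longrightarrow> J n x \<longleftrightarrow> x = y" using ex1[OF n] by blast
    then have "j n = y" unfolding j_def by (intro the_equality) auto
    then show "j n \<in> car L" "\<And>x. x \<in> car L \<Longrightarrow> J n x \<longleftrightarrow> j n = x" using y by auto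
  qed
  show thesis
  proof
    have "dfn (Nm \<otimes> L) (\<lambda>w. j (fst w) = snd w)"
      by (rule dfn_cong[THEN iffD1, OF _ J_dfn]) (use j(2) in auto)
    then show "dfun Nm L j" unfolding dfun_def using j(1) by simp
    show "j zr = z" using j(2)[of zr z] J_zr[OF z] z by simp
    show "j (suc n) = f (j n)" if "n \<in> Num" for n
      using that j J_suc fL by (metis suc_Num)
  qed
qed

end

section \<open>Solidity\<close>
text \<open>Links \<open>dfun\<close> with the graphs in the definition of
  \<open>solid\<close>.\<close>

lemma (in relstruct) dfun_elem_iff:
  "dfun (elem s) L f \<longleftrightarrow> (\<forall>x\<in>univ M s. f x \<in> car L) \<and>
     definable ar M (s # srt L) ((\<lambda>x. x # cod L (f x)) ` univ M s)"
proof -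
  have "cod (elem s \<otimes> L) ` {w \<in> car (elem s \<otimes> L). f (fst w) = snd w} = (\<lambda>x. x # cod L (f x)) ` univ M s"
    if "\<forall>x\<in>univ M s. f x \<in> car L"
  proof
    show "(\<lambda>x. x # cod L (f x)) ` univ M s \<subseteq>
        cod (elem s \<otimes> L) ` {w \<in> car (elem s \<otimes> L). f (fst w) = snd w}"
      using that by (auto intro!: image_eqI[of _ _ "(x, f x)" for x])
  qed auto
  then show ?thesis unfolding dfun_def dfn_def by auto
qed

section \<open>Embedding the numbers of a model into those of an interpreted one\<close>

locale z2_interp = M: z2 M + N: z2 N + interp z2_ar M N d
  for M :: "(z2_sort, z2_pred, 'a) struct" and N :: "(z2_sort, z2_pred, 'a list) struct"
    and d :: "z2_sort \<Rightarrow> z2_sort list"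
begin

abbreviation "LNm \<equiv> lift d N.Nm"
abbreviation "LSt \<equiv> lift d N.St"

text \<open>Addition of \<open>N\<close> is definable in \<open>N\<close>, hence also in
  \<open>M\<close>, so that inductions in \<open>M\<close> may mention it.\<close>

lemma dfun_N_add:
  assumes "M.dobj K" "M.dfun K LNm f" "M.dfun K LNm g"
  shows "M.dfun K LNm (\<lambda>x. N.add (f x) (g x))"
proof -
  have "M.dfun (LNm \<otimes> LNm) LNm (\<lambda>w. N.add (fst w) (snd w))"
    using dfun_lift[OF N.dfun_add_aux] by (simp add: lift_prod)
  from M.dfun_comp2[OF assms(1) _ _ _ this assms(2,3)] show ?thesis by simp
qed

lemma dfun_N_mul:
  assumes "M.dobj K" "M.dfun K LNm f" "M.dfun K LNm g"
  shows "M.dfun K LNm (\<lambda>x. N.mul (f x) (g x))"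
proof -
  have "M.dfun (LNm \<otimes> LNm) LNm (\<lambda>w. N.mul (fst w) (snd w))"
    using dfun_lift[OF N.dfun_mul_aux] by (simp add: lift_prod)
  from M.dfun_comp2[OF assms(1) _ _ _ this assms(2,3)] show ?thesis by simp
qed

lemma dfn_N_mem:
  assumes "M.dobj K" "M.dfun K LNm f" "M.dfun K LSt g"
  shows "M.dfn K (\<lambda>x. N.mem (f x) (g x))"
proof -
  have "N.dfn (N.Nm \<otimes> N.St) (\<lambda>w. N.mem (fst w) (snd w))"
    by (intro N.dfn_intros; simp)
  then have "M.dfn (LNm \<otimes> LSt) (\<lambda>w. N.mem (fst w) (snd w))"
    using dfn_lift by (simp only: lift_prod[symmetric])
  from M.dfn_comp2[OF assms(1) _ _ this assms(2,3)] show ?thesis by simp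
qed

definition embedding :: "('a \<Rightarrow> 'a list) \<Rightarrow> bool" where
  "embedding j \<longleftrightarrow> M.dfun M.Nm LNm j \<and> j M.zr = N.zr \<and> (\<forall>n\<in>M.Num. j (M.suc n) = N.suc (j n))"

lemma embedding_ex: "\<exists>j. embedding j"
proof -
  have "N.dfun N.Nm N.Nm N.suc"
    using N.dfun_suc[OF N.dobj_elem N.dfun_id[OF N.dobj_elem]] .
  then have "M.dfun LNm LNm N.suc" by (rule dfun_lift)
  from M.recursion[OF dobj_lift_elem _ this, of N.zr]
  show ?thesis unfolding embedding_def by (metis N.elem_simps(1) N.zr_Num lift_simps(1))
qed

context
  fixes j assumes j: "embedding j"
begin

lemma j_dfun: "M.dfun M.Nm LNm j" and j_zr: "j M.zr = N.zr"
  and j_suc: "n \<in> M.Num \<Longrightarrow> j (M.suc n) = N.suc (j n)"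
  using j unfolding embedding_def by auto

lemma j_Num: "x \<in> M.Num \<Longrightarrow> j x \<in> N.Num"
  using M.dfun_in[OF j_dfun, of x] by simp

lemmas j_simps = j_zr j_suc j_Num

lemma dfun_j: "M.dobj K \<Longrightarrow> M.dfun K M.Nm f \<Longrightarrow> M.dfun K LNm (\<lambda>x. j (f x))"
  by (rule M.dfun_comp[OF _ _ _ _ j_dfun]) simp_all

text \<open>The equations proved by induction below hold between numbers of \<open>N\<close>, hence
  the instance of \<open>dfn_eq\<close> at \<open>LNm\<close>.\<close>

lemmas j_intros = M.dfn_eq[where L = LNm] dfun_N_add dfun_N_mul dfun_j M.dfun_add M.dfun_mul
  M.dfun_const M.dfun_id

lemma j_on: "j M.on = N.on"
  using j_suc[OF M.zr_Num] by (simp add: M.suc_zr N.suc_zr j_zr)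

lemma j_add: "x \<in> M.Num \<Longrightarrow> y \<in> M.Num \<Longrightarrow> j (M.add x y) = N.add (j x) (j y)"
  by (rule M.num_induct[where P = "\<lambda>y. j (M.add x y) = N.add (j x) (j y)"])
    ((intro j_intros)?; simp add: j_simps)+

lemma j_mul: "x \<in> M.Num \<Longrightarrow> y \<in> M.Num \<Longrightarrow> j (M.mul x y) = N.mul (j x) (j y)"
  by (rule M.num_induct[where P = "\<lambda>y. j (M.mul x y) = N.mul (j x) (j y)"])
    ((intro j_intros)?; simp add: j_simps j_add)+

lemma j_lt_imp:
  assumes "x \<in> M.Num" "y \<in> M.Num" "M.lt x y"
  shows "N.lt (j x) (j y)"
proof -
  obtain z where "z \<in> M.Num" "y = M.suc (M.add x z)" using assms M.lt_iff by blast
  then show ?thesis using assms by (simp add: j_simps j_add)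
qed

text \<open>The converse of \<open>j_lt_imp\<close> follows from trichotomy in \<open>M\<close>,
  since the order of \<open>N\<close> is irreflexive and transitive.\<close>

lemma j_lt:
  assumes "x \<in> M.Num" "y \<in> M.Num"
  shows "N.lt (j x) (j y) \<longleftrightarrow> M.lt x y"
proof
  assume less: "N.lt (j x) (j y)"
  have irrefl: "\<not> N.lt (j x) (j x)" using assms j_Num by simp
  moreover have "\<not> N.lt (j y) (j x)"
    using less irrefl N.lt_trans[OF j_Num j_Num j_Num] assms by blast
  ultimately show "M.lt x y"
    using less M.lt_trichotomy[OF assms] j_lt_imp[OF assms(2,1)] by auto
qed (rule j_lt_imp[OF assms])

text \<open>A strictly increasing map on a linear order is injective.\<close>

lemma j_inj:
  assumes "x \<in> M.Num" "y \<in> M.Num"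
  shows "j x = j y \<longleftrightarrow> x = y"
proof
  assume eq: "j x = j y"
  have "\<not> N.lt (j x) (j y)" "\<not> N.lt (j y) (j x)" unfolding eq using assms j_Num by simp_all
  then show "x = y"
    using M.lt_trichotomy[OF assms] j_lt_imp[OF assms] j_lt_imp[OF assms(2,1)] by blast
qed simp

end

end

section \<open>The isomorphism between the outer model and the interpreted one\<close>

lemma definable_isomorphism:
  fixes M :: "(z2_sort, z2_pred, 'a) struct" and N :: "(z2_sort, z2_pred, 'a list) struct"
    and M' :: "(z2_sort, z2_pred, 'a list list) struct"
  assumes models: "is_model z2_ar M Z2" "is_model z2_ar N Z2" "is_model z2_ar M' Z2"
    and interps: "defines_struct z2_ar d M N" "defines_struct z2_ar d' N M'"
    and iso: "isomorphism z2_ar M M' i0"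
    and graph: "\<And>s. definable z2_ar M (s # concat (map d (d' s))) ((\<lambda>x. x # concat (i0 s x)) ` univ M s)"
  shows "\<exists>i. isomorphism z2_ar M N i \<and>
    (\<forall>s. definable z2_ar M (s # d s) ((\<lambda>x. x # i s x) ` univ M s))"
proof -
  interpret M: z2 M using models(1) by unfold_locales (auto simp: is_model_def)
  interpret N: z2 N using models(2) by unfold_locales (auto simp: is_model_def)
  interpret M': z2 M' using models(3) by unfold_locales (auto simp: is_model_def)
  interpret MN: z2_interp M N d by unfold_locales (rule interps)
  interpret NM: z2_interp N M' d' by unfold_locales (rule interps)
  obtain j j' where j: "MN.embedding j" and j': "NM.embedding j'"
    using MN.embedding_ex NM.embedding_ex by blast
  have i0_bij: "bij_betw (i0 s) (univ M s) (univ M' s)" for s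
    using iso unfolding isomorphism_def by blast
  have i0_in: "i0 s x \<in> univ M' s" if "x \<in> univ M s" for s x
    using bij_betwE[OF i0_bij] that by blast
  have i0_surj: "\<exists>x\<in>univ M s. i0 s x = y" if "y \<in> univ M' s" for s y
    using that unfolding bij_betw_imp_surj_on[OF i0_bij, symmetric] by blast
  have i0_rel: "as \<in> rel M P \<longleftrightarrow> map2 i0 (z2_ar P) as \<in> rel M' P" if "as \<in> tuples M (z2_ar P)" for as P
    using iso that unfolding isomorphism_def by blast
  \<comment> \<open>The sorts of \<open>M'\<close> as objects over \<open>M\<close>, lifted first to
    \<open>N\<close> and then to \<open>M\<close>. Their codes are the flattened tuples in the
    hypothesis on the graph of \<open>i0\<close>.\<close>
  let ?L = "\<lambda>s. lift d (lift d' (M'.elem s))"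
  have L: "M.dobj (?L s)" for s by simp
  have i0_dfun: "M.dfun (M.elem s) (?L s) (i0 s)" for s
    unfolding M.dfun_elem_iff using graph[of s] i0_in by simp
  have i0_zr: "i0 NumSort M.zr = M'.zr"
    using i0_rel[of "[M.zr]" PZero] by (simp add: M.zr_iff M'.zr_iff)
  have i0_on: "i0 NumSort M.on = M'.on"
    using i0_rel[of "[M.on]" POne] by (simp add: M.on_iff M'.on_iff)
  \<comment> \<open>Successor is addition of \<open>on\<close>, so it is preserved because addition
    and \<open>on\<close> are.\<close>
  have i0_suc: "i0 NumSort (M.suc x) = M'.suc (i0 NumSort x)" if "x \<in> M.Num" for x
    using i0_rel[of "[x, M.on, M.suc x]" PAdd] that
    by (simp add: M.add_iff M'.add_iff M.suc_def M'.suc_def i0_on i0_in)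
  have i0_mem: "M.mem x X \<longleftrightarrow> M'.mem (i0 NumSort x) (i0 SetSort X)" if "x \<in> M.Num" "X \<in> M.Sets" for x X
    using i0_rel[of "[x, X]" PMem] that by (simp add: M.mem_def M'.mem_def)
  have jj': "j' (j x) = i0 NumSort x" if "x \<in> M.Num" for x
    using that
  proof (rule M.num_induct[where P = "\<lambda>x. j' (j x) = i0 NumSort x", rotated -1])
    \<comment> \<open>As \<open>j'\<close> is definable in \<open>N\<close>, it is definable in
      \<open>M\<close>; both sides of the equation are then definable in \<open>M\<close>, and
      induction there applies.\<close>
    have "M.dfun MN.LNm (?L NumSort) j'"
      by (rule MN.dfun_lift) (rule NM.j_dfun[OF j'])
    then have "M.dfun M.Nm (?L NumSort) (\<lambda>x. j' (j x))"
      by (rule M.dfun_comp[rotated 4]) (simp_all add: MN.j_dfun[OF j])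
    then show "M.dfn M.Nm (\<lambda>x. j' (j x) = i0 NumSort x)"
      by (rule M.dfn_eq[rotated 2]) (simp_all add: i0_dfun)
    show "j' (j M.zr) = i0 NumSort M.zr"
      by (simp add: MN.j_zr[OF j] NM.j_zr[OF j'] i0_zr)
    show "j' (j (M.suc x)) = i0 NumSort (M.suc x)" if "x \<in> M.Num" "j' (j x) = i0 NumSort x" for x
      using that by (simp add: MN.j_suc[OF j] NM.j_suc[OF j'] MN.j_Num[OF j] i0_suc)
  qed
  have j_surj: "\<exists>x\<in>M.Num. j x = y" if y: "y \<in> N.Num" for y
  proof -
    obtain x where x: "x \<in> M.Num" "i0 NumSort x = j' y"
      using i0_surj[OF NM.j_Num[OF j' y]] by blast
    then have "j' (j x) = j' y" using jj' by simp
    then have "j x = y" using NM.j_inj[OF j' MN.j_Num[OF j x(1)] y] by blast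
    then show ?thesis using x(1) by blast
  qed
  \<comment> \<open>A first-order condition on the pair of sets, hence definable in
    \<open>M\<close>; it will turn out to be the graph of the isomorphism on sets.\<close>
  define match where "match X A \<longleftrightarrow> (\<forall>m\<in>M.Num. M.mem m X \<longleftrightarrow> N.mem (j m) A)" for X A
  have match_ex: "\<exists>A\<in>N.Sets. match X A" if X: "X \<in> M.Sets" for X
  proof -
    \<comment> \<open>\<open>i0 SetSort X\<close> enters as a parameter from \<open>M'\<close>, so
      of the maps involved only \<open>j'\<close> has to be definable in \<open>N\<close>.\<close>
    have "N.dfn N.Nm (\<lambda>b. M'.mem (j' b) (i0 SetSort X))"
      using X i0_in by (intro NM.dfn_N_mem NM.j_dfun[OF j'] N.dfun_const; simp)
    from N.comprehension[OF this] obtain A where A: "A \<in> N.Sets"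
      "\<And>b. b \<in> N.Num \<Longrightarrow> N.mem b A \<longleftrightarrow> M'.mem (j' b) (i0 SetSort X)" by blast
    have "match X A" unfolding match_def
      using A(2) MN.j_Num[OF j] jj' i0_mem[OF _ X] by simp
    then show ?thesis using A(1) by blast
  qed
  have match_ex': "\<exists>X\<in>M.Sets. match X A" if A: "A \<in> N.Sets" for A
  proof -
    have "M.dfn M.Nm (\<lambda>m. N.mem (j m) A)"
      using A by (intro MN.dfn_N_mem MN.j_dfun[OF j] M.dfun_const; simp)
    from M.comprehension[OF this] show ?thesis unfolding match_def .
  qed
  have match_right: "A = B" if "A \<in> N.Sets" "B \<in> N.Sets" "match X A" "match X B" for X A B
  proof (rule N.set_ext[OF that(1,2)])
    fix b assume "b \<in> N.Num"
    \<comment> \<open>Matching speaks only of numbers in the range of \<open>j\<close>;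
      extensionality in \<open>N\<close> concerns all of them, so surjectivity of \<open>j\<close>
      is essential.\<close>
    then obtain m where "m \<in> M.Num" "j m = b" using j_surj by blast
    then show "N.mem b A \<longleftrightarrow> N.mem b B" using that(3,4) unfolding match_def by blast
  qed
  have match_left: "X = Y" if "X \<in> M.Sets" "Y \<in> M.Sets" "match X A" "match Y A" for X Y A
    using that unfolding match_def by (intro M.set_ext) auto
  define k where "k X = (THE A. A \<in> N.Sets \<and> match X A)" for X
  have k: "k X \<in> N.Sets" "match X (k X)" if X: "X \<in> M.Sets" for X
  proof -
    have "\<exists>!A. A \<in> N.Sets \<and> match X A" using match_ex[OF X] match_right by blast
    then have "k X \<in> N.Sets \<and> match X (k X)" unfolding k_def by (rule theI')
    then show "k X \<in> N.Sets" "match X (k X)" by blast+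
  qed
  have k_eq: "k X = A \<longleftrightarrow> match X A" if "X \<in> M.Sets" "A \<in> N.Sets" for X A
    using k[OF that(1)] match_right[OF _ that(2)] by blast
  have k_mem: "N.mem (j m) (k X) \<longleftrightarrow> M.mem m X" if "m \<in> M.Num" "X \<in> M.Sets" for m X
    using k(2)[OF that(2)] that(1) unfolding match_def by blast
  \<comment> \<open>\<open>k\<close> is given by a description; its graph becomes definable by way
    of \<open>match\<close>.\<close>
  have "M.dfn (M.St \<otimes> MN.LSt) (\<lambda>w. match (fst w) (snd w))"
    unfolding match_def
    by (intro M.dfn_intros MN.dfn_N_mem MN.dfun_j[OF j] MN.dobj_lift_elem; simp)
  moreover have "match (fst w) (snd w) \<longleftrightarrow> k (fst w) = snd w" if "w \<in> car (M.St \<otimes> MN.LSt)" for w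
    using that k_eq by auto
  ultimately have "M.dfn (M.St \<otimes> MN.LSt) (\<lambda>w. k (fst w) = snd w)"
    by (rule M.dfn_cong[THEN iffD1, rotated])
  then have k_dfun: "M.dfun M.St MN.LSt k"
    unfolding M.dfun_def using k(1) by simp
  define i where "i s = (case s of NumSort \<Rightarrow> j | SetSort \<Rightarrow> k)" for s
  have i_simps: "i NumSort = j" "i SetSort = k" by (simp_all add: i_def)
  have i_dfun: "M.dfun (M.elem s) (lift d (N.elem s)) (i s)" for s
    by (cases s) (simp_all add: i_simps MN.j_dfun[OF j] k_dfun)
  have "bij_betw j M.Num N.Num"
    by (rule bij_betwI') (use MN.j_inj[OF j] MN.j_Num[OF j] j_surj in blast)+
  moreover have "bij_betw k M.Sets N.Sets"
  proof (rule bij_betwI')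
    show "k X = k Y \<longleftrightarrow> X = Y" if "X \<in> M.Sets" "Y \<in> M.Sets" for X Y
      using that k match_left by metis
    show "\<exists>X\<in>M.Sets. A = k X" if "A \<in> N.Sets" for A
      using match_ex'[OF that] k_eq[OF _ that] by blast
  qed (rule k)
  ultimately have bij: "bij_betw (i s) (univ M s) (univ N s)" for s
    by (cases s) (simp_all add: i_simps)
  have "as \<in> rel M P \<longleftrightarrow> map2 i (z2_ar P) as \<in> rel N P" if as: "as \<in> tuples M (z2_ar P)" for P as
  proof (cases P)
    case PZero
    then obtain a where "as = [a]" "a \<in> M.Num" using as by (auto simp: tuples_iff list_all2_Cons1)
    \<comment> \<open>As \<open>j\<close> is injective, \<open>j a = N.zr\<close> forces
      \<open>a = M.zr\<close>. The graphs of the other constant and of the operations are reflected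
      in the same way.\<close>
    then show ?thesis using PZero MN.j_inj[OF j, of a M.zr]
      by (simp add: i_simps M.zr_iff N.zr_iff MN.j_zr[OF j])
  next
    case POne
    then obtain a where "as = [a]" "a \<in> M.Num" using as by (auto simp: tuples_iff list_all2_Cons1)
    then show ?thesis using POne MN.j_inj[OF j, of a M.on]
      by (simp add: i_simps M.on_iff N.on_iff MN.j_on[OF j])
  next
    case PAdd
    then obtain a b c where "as = [a, b, c]" "a \<in> M.Num" "b \<in> M.Num" "c \<in> M.Num"
      using as by (auto simp: tuples_iff list_all2_Cons1)
    then show ?thesis using PAdd MN.j_inj[OF j, of c "M.add a b"]
      by (simp add: i_simps M.add_iff N.add_iff MN.j_add[OF j] MN.j_Num[OF j])
  next
    case PMul
    then obtain a b c where "as = [a, b, c]" "a \<in> M.Num" "b \<in> M.Num" "c \<in> M.Num"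
      using as by (auto simp: tuples_iff list_all2_Cons1)
    then show ?thesis using PMul MN.j_inj[OF j, of c "M.mul a b"]
      by (simp add: i_simps M.mul_iff N.mul_iff MN.j_mul[OF j] MN.j_Num[OF j])
  next
    case PLess
    then obtain a b where "as = [a, b]" "a \<in> M.Num" "b \<in> M.Num"
      using as by (auto simp: tuples_iff list_all2_Cons1)
    then show ?thesis using PLess MN.j_lt[OF j, of a b]
      by (simp add: i_simps M.lt_def N.lt_def)
  next
    case PMem
    then obtain a b where "as = [a, b]" "a \<in> M.Num" "b \<in> M.Sets"
      using as by (auto simp: tuples_iff list_all2_Cons1)
    then show ?thesis using PMem k_mem[of a b]
      by (simp add: i_simps M.mem_def N.mem_def)
  qed
  then have "isomorphism z2_ar M N i" unfolding isomorphism_def using bij by blast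
  moreover have "definable z2_ar M (s # d s) ((\<lambda>x. x # i s x) ` univ M s)" for s
    using i_dfun[of s] unfolding M.dfun_elem_iff by simp
  ultimately show ?thesis by blast
qed

theorem theorem2p5:
  shows "solid TYPE('a) z2_ar Z2"
  unfolding solid_def using definable_isomorphism by blast

end
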